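(* Let $C\subset\mathbb F_q^d$ be the cone $C=\{x\in\mathbb F_q^d: x_1^2+\cdots+x_{d-2}^2=x_{d-1}x_d\}$, let $\sigma$ be the normalized surface measure on $C$, and let $A_C$ be the restricted averaging operator $A_Cf=(f\ast\sigma)|_C$. Then: (1) if $d\ge 6$ is even, then for all functions $f:\mathbb F_q^d\to\mathbb C$, $$\|A_Cf\|_{L^{d-2}(C,\sigma)}\lesssim\|f\|_{L^{\frac{d}{d-1}}(\mathbb F_q^d,dx)};$$ (2) if $d\ge 4$ is even, then for all functions $f:\mathbb F_q^d\to\mathbb C$, $$\|A_Cf\|_{L^{\frac{d^2-2d+2}{d-2}}(C,\sigma)}\lesssim\|f\|_{L^{\frac{d^2-2d+2}{d^2-3d+2}}(\mathbb F_q^d,dx)}.$$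
   Context: $\mathbb F_q$ is the finite field with $q$ elements, where $q$ is a power of an odd prime. $dx$ is the normalized counting measure on $\mathbb F_q^d$: for $f:\mathbb F_q^d\to\mathbb C$ and $1\le p<\infty$, $\|f\|_{L^p(\mathbb F_q^d,dx)}=\big(q^{-d}\sum_{x\in\mathbb F_q^d}|f(x)|^p\big)^{1/p}$. The normalized surface measure $\sigma$ on $C$ gives each point of $C$ mass $1/|C|$, so for $g:C\to\mathbb C$ and $1\le r<\infty$, $\|g\|_{L^r(C,\sigma)}=\big(|C|^{-1}\sum_{x\in C}|g(x)|^r\big)^{1/r}$. Explicitly, $A_Cf(y)=f\ast\sigma(y)=\frac1{|C|}\sum_{x\in C}f(y-x)$ for $y\in C$. The notation $X\lesssim Y$ means $X\le c\,Y$ with a constant $c>0$ independent of $q$ and of the function $f$ ($c$ may depend on the dimension $d$ only). *)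

theory Defs
  imports Complex_Main "HOL-Library.FuncSet" "HOL-Computational_Algebra.Primes" "HOL-Algebra.Ring"
begin

text \<open>
  The implicit constants below are uniform in \<open>q\<close>, so the field must be quantified inside the
  formula, after the constant. Hence finite fields are \<open>HOL-Algebra\<close> records over a carrier
  type \<open>'a\<close>, not types of class \<open>field\<close>. If \<open>'a\<close> is infinite (e.g. \<open>nat\<close>), every finite
  field is isomorphic to one with carrier in \<open>'a\<close>.
\<close>

definition finite_field_odd :: "'a ring \<Rightarrow> bool" where
  "finite_field_odd F \<longleftrightarrow>
     field F \<and> finite (carrier F) \<and>
     (\<exists>p n :: nat. prime p \<and> odd p \<and> n \<ge> 1 \<and> card (carrier F) = p ^ n)"

definition coord_space :: "'a ring \<Rightarrow> nat \<Rightarrow> (nat \<Rightarrow> 'a) set" where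
  "coord_space F d = {1..d} \<rightarrow>\<^sub>E carrier F"

definition vec_minus :: "'a ring \<Rightarrow> nat \<Rightarrow> (nat \<Rightarrow> 'a) \<Rightarrow> (nat \<Rightarrow> 'a) \<Rightarrow> (nat \<Rightarrow> 'a)" where
  "vec_minus F d y x = (\<lambda>i\<in>{1..d}. y i \<ominus>\<^bsub>F\<^esub> x i)"

definition cone :: "'a ring \<Rightarrow> nat \<Rightarrow> (nat \<Rightarrow> 'a) set" where
  "cone F d = {x \<in> coord_space F d.
     (\<Oplus>\<^bsub>F\<^esub>i\<in>{1..d - 2}. x i [^]\<^bsub>F\<^esub> (2::nat)) = x (d - 1) \<otimes>\<^bsub>F\<^esub> x d}"

text \<open>
  A function on \<open>F\<^sup>d\<close> is a total function on \<open>nat \<Rightarrow> 'a\<close>; only its values on \<open>coord_space F d\<close>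
  are ever used.
\<close>

definition Lp_norm_dx ::
    "'a ring \<Rightarrow> nat \<Rightarrow> real \<Rightarrow> ((nat \<Rightarrow> 'a) \<Rightarrow> complex) \<Rightarrow> real" where
  "Lp_norm_dx F d p f =
     (1 / real (card (carrier F)) ^ d * (\<Sum>x\<in>coord_space F d. cmod (f x) powr p)) powr (1 / p)"

definition Lr_norm_cone ::
    "'a ring \<Rightarrow> nat \<Rightarrow> real \<Rightarrow> ((nat \<Rightarrow> 'a) \<Rightarrow> complex) \<Rightarrow> real" where
  "Lr_norm_cone F d r g =
     (1 / real (card (cone F d)) * (\<Sum>x\<in>cone F d. cmod (g x) powr r)) powr (1 / r)"

definition cone_average ::
    "'a ring \<Rightarrow> nat \<Rightarrow> ((nat \<Rightarrow> 'a) \<Rightarrow> complex) \<Rightarrow> (nat \<Rightarrow> 'a) \<Rightarrow> complex" where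
  "cone_average F d f =
     (\<lambda>y\<in>cone F d. 1 / of_nat (card (cone F d)) * (\<Sum>x\<in>cone F d. f (vec_minus F d y x)))"

end

theory Submission
  imports Defs "HOL-Algebra.Multiplicative_Group"
begin

text \<open>
  Write \<open>Q\<close> for the quadratic form cutting out the cone \<open>C\<close> and \<open>b\<close> for its polar form. For \<open>y\<close>
  in \<open>C\<close>, the point \<open>y - x\<close> lies in \<open>C\<close> iff \<open>Q x = b x y\<close>; so averaging over the cone, restricted
  to the cone, counts incidences for a relation that is linear in \<open>y\<close>, and no Fourier analysis is
  needed. For \<open>x\<close> off the cone the inversion \<open>x / Q x\<close> turns the relation into \<open>b x y = 1\<close>, and a
  second moment over the whole space gives square-root cancellation. For \<open>x\<close> on the cone the
  relation is \<open>b x y = 0\<close>; second moments over the whole space and over \<open>C\<close> both enter, the latter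
  because sections of \<open>C\<close> by one or two tangent hyperplanes can be counted by translating along
  isotropic vectors. With \<open>N = q^d\<close>, \<open>L = N / q\<close>, \<open>W = sqrt N\<close> and \<open>m t = min t (sqrt t)\<close>, sets of
  sizes \<open>e\<close> and \<open>g\<close> have at most a constant times \<open>e g / q + L m (e g / L) + N m (e / W) m (g / W)\<close>
  incidences. Both exponent pairs of the theorem are critical for these terms, but the exponents
  \<open>\<alpha> = 1/p\<close> and \<open>\<beta> = 1 - 1/r\<close> lie strictly between \<open>1/2\<close> and \<open>1\<close> and differ, so the sum over
  dyadic level sets decays geometrically in every direction and gives the strong-type bound without
  interpolation loss.
\<close>

section \<open>Incidences and second moments\<close>

text \<open>The obstacle is homogeneity. In \<open>b x y = 1\<close>, distinct proportional
  \<open>y\<close> give disjoint hyperplanes, so only the diagonal of the Gram matrix costs anything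
  and the squared deviation is at most \<open>e g N / q\<close>. In \<open>b x y = 0\<close>, all
  nonzero multiples of \<open>y\<close> give one hyperplane, and the second moment over the whole
  space loses a factor \<open>q\<close>. Taken over \<open>C\<close> it recovers that factor, but
  independent vectors may now correlate with strength up to \<open>|card C - N / q|\<close>, which
  is at most of order \<open>sqrt N\<close>; this is where \<open>W\<close> comes from. The two
  exponent pairs solve one system, which asks that the \<open>L\<close> term and the
  \<open>W\<close> term scale with \<open>q\<close> like the main term: one solution has
  min(\<alpha>, \<beta>) = \<beta>, the other min(\<alpha>, \<beta>) = \<alpha>. The exponents must
  differ because the \<open>L\<close> term sees only the product \<open>e g\<close>: it is constant
  along \<open>i/\<alpha> + j/\<beta> = const\<close>, and there only the weight
  \<open>2^(-i-j)\<close> can supply decay. For \<alpha> = \<beta> it does not, and a logarithm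
  would be lost.\<close>

definition incidences :: "('x \<Rightarrow> 'y \<Rightarrow> bool) \<Rightarrow> 'x set \<Rightarrow> 'y set \<Rightarrow> real" where
  "incidences P E G = (\<Sum>x\<in>E. \<Sum>y\<in>G. of_bool (P x y))"

text \<open>The better of a trivial bound and a square-root bound, measured in units of the scale at
  which they cross: linear below 1, square root above.\<close>

definition sqrt_min :: "real \<Rightarrow> real" where
  "sqrt_min t = min t (sqrt t)"

lemma sqrt_min_le_1: "0 \<le> t \<Longrightarrow> t \<le> 1 \<Longrightarrow> sqrt_min t = t"
  unfolding sqrt_min_def by (smt (verit) real_sqrt_le_1_iff real_sqrt_ge_0_iff mult_left_le_one_le real_sqrt_mult_self)

lemma sqrt_min_ge_1: "1 \<le> t \<Longrightarrow> sqrt_min t = sqrt t"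
  unfolding sqrt_min_def
  by (smt (verit) real_sqrt_ge_one mult_le_cancel_left1 real_sqrt_mult_self)

lemma sqrt_min_nonneg: "0 \<le> t \<Longrightarrow> 0 \<le> sqrt_min t"
  unfolding sqrt_min_def by simp

lemma sqrt_min_mono: "s \<le> t \<Longrightarrow> sqrt_min s \<le> sqrt_min t"
  unfolding sqrt_min_def by (auto simp: min_le_iff_disj)

lemma card_conv_sum_of_bool: "finite A \<Longrightarrow> real (card {x\<in>A. P x}) = (\<Sum>x\<in>A. of_bool (P x))"
  by (simp add: of_bool_def sum.If_cases Int_def)

text \<open>Cauchy-Schwarz against the constant function, read off from the nonnegativity of the
  variance around the mean \<open>m\<close>.\<close>

lemma sum_power2_le_card_mult:
  fixes D :: "'x \<Rightarrow> real"
  assumes "finite E"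
  shows "(\<Sum>x\<in>E. D x)\<^sup>2 \<le> real (card E) * (\<Sum>x\<in>E. (D x)\<^sup>2)"
proof (cases "E = {}")
  case False
  define e where "e = real (card E)"
  define m where "m = (\<Sum>x\<in>E. D x) / e"
  have e: "0 < e" using False assms by (simp add: e_def card_gt_0_iff)
  then have sum_eq: "(\<Sum>x\<in>E. D x) = e * m" by (simp add: m_def)
  have "0 \<le> (\<Sum>x\<in>E. (D x - m)\<^sup>2)" by (intro sum_nonneg) auto
  also have "\<dots> = (\<Sum>x\<in>E. (D x)\<^sup>2 - 2 * m * D x + m\<^sup>2)"
    by (simp add: power2_diff algebra_simps)
  also have "\<dots> = (\<Sum>x\<in>E. (D x)\<^sup>2) - 2 * m * (e * m) + e * m\<^sup>2"
    by (simp add: sum.distrib sum_subtractf sum_distrib_left[symmetric] sum_eq e_def)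
  finally have "e * m\<^sup>2 \<le> (\<Sum>x\<in>E. (D x)\<^sup>2)" by (simp add: power2_eq_square algebra_simps)
  then have "e * (e * m\<^sup>2) \<le> e * (\<Sum>x\<in>E. (D x)\<^sup>2)" using e by (intro mult_left_mono) auto
  then show ?thesis by (simp add: sum_eq e_def power2_eq_square mult_ac)
qed simp

lemma incidences_swap: "incidences P E G = incidences (\<lambda>y x. P x y) G E"
  unfolding incidences_def by (rule sum.swap)

lemma incidences_le_card_mult: "incidences P E G \<le> real (card E) * real (card G)"
proof -
  have "incidences P E G \<le> (\<Sum>x\<in>E. \<Sum>y\<in>G. 1)"
    unfolding incidences_def by (intro sum_mono) auto
  then show ?thesis by simp
qed

text \<open>Expand the square: each entry on the right is the inner product over \<open>X\<close> of
  the indicators of \<open>P x y\<close> and \<open>P x y'\<close>, both recentred by the expected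
  density \<open>1/q\<close>.\<close>

lemma second_moment:
  fixes q :: real
  assumes "finite X" "finite G"
  shows "(\<Sum>x\<in>X. ((\<Sum>y\<in>G. of_bool (P x y)) - real (card G) / q)\<^sup>2) =
    (\<Sum>y\<in>G. \<Sum>y'\<in>G. real (card {x\<in>X. P x y \<and> P x y'}) - real (card {x\<in>X. P x y}) / q
       - real (card {x\<in>X. P x y'}) / q + real (card X) / q\<^sup>2)"
proof -
  have "(\<Sum>x\<in>X. ((\<Sum>y\<in>G. of_bool (P x y)) - real (card G) / q)\<^sup>2)
      = (\<Sum>x\<in>X. \<Sum>y\<in>G. \<Sum>y'\<in>G. (of_bool (P x y) - 1/q) * (of_bool (P x y') - 1/q))"
    by (intro sum.cong refl) (simp add: power2_eq_square sum_product[symmetric] sum_subtractf)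
  also have "\<dots> = (\<Sum>y\<in>G. \<Sum>y'\<in>G. \<Sum>x\<in>X. (of_bool (P x y) - 1/q) * (of_bool (P x y') - 1/q))"
    by (subst sum.swap, intro sum.cong refl, subst sum.swap) simp
  also have "\<dots> = (\<Sum>y\<in>G. \<Sum>y'\<in>G. real (card {x\<in>X. P x y \<and> P x y'}) - real (card {x\<in>X. P x y}) / q
       - real (card {x\<in>X. P x y'}) / q + real (card X) / q\<^sup>2)"
  proof (intro sum.cong refl)
    fix y y'
    have "(\<Sum>x\<in>X. (of_bool (P x y) - 1/q) * (of_bool (P x y') - 1/q)) =
      (\<Sum>x\<in>X. of_bool (P x y \<and> P x y') - of_bool (P x y) / q - of_bool (P x y') / q + 1 / q\<^sup>2)"
      by (intro sum.cong refl) (auto simp: algebra_simps power2_eq_square)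
    also have "\<dots> = real (card {x\<in>X. P x y \<and> P x y'}) - real (card {x\<in>X. P x y}) / q
       - real (card {x\<in>X. P x y'}) / q + real (card X) / q\<^sup>2"
      unfolding card_conv_sum_of_bool[OF assms(1)]
      by (simp only: sum.distrib sum_subtractf sum_divide_distrib[symmetric]) simp
    finally show "(\<Sum>x\<in>X. (of_bool (P x y) - 1/q) * (of_bool (P x y') - 1/q)) = \<dots>" .
  qed
  finally show ?thesis .
qed

text \<open>Cauchy-Schwarz over \<open>E\<close>, after which \<open>E\<close> is enlarged to
  \<open>X\<close>: the structure of \<open>E\<close> is given up, and what remains is a second
  moment that pair counts determine.\<close>

lemma incidences_deviation:
  fixes q :: real
  assumes "finite X" "finite G" "E \<subseteq> X"
    and bound: "(\<Sum>y\<in>G. \<Sum>y'\<in>G. real (card {x\<in>X. P x y \<and> P x y'}) - real (card {x\<in>X. P x y}) / q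
       - real (card {x\<in>X. P x y'}) / q + real (card X) / q\<^sup>2) \<le> B"
  shows "(incidences P E G - real (card E) * real (card G) / q)\<^sup>2 \<le> real (card E) * B"
proof -
  let ?D = "\<lambda>x. (\<Sum>y\<in>G. of_bool (P x y)) - real (card G) / q"
  have "(incidences P E G - real (card E) * real (card G) / q)\<^sup>2 = (\<Sum>x\<in>E. ?D x)\<^sup>2"
    by (simp add: incidences_def sum_subtractf)
  also have "\<dots> \<le> (\<Sum>x\<in>E. (?D x)\<^sup>2) * real (card E)"
    using sum_power2_le_card_mult[of E ?D] finite_subset[OF assms(3,1)] by (simp add: mult.commute)
  also have "\<dots> \<le> (\<Sum>x\<in>X. (?D x)\<^sup>2) * real (card E)"
    using assms by (intro mult_right_mono sum_mono2) auto
  also have "\<dots> \<le> real (card E) * B"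
    unfolding second_moment[OF assms(1,2)] mult.commute[of _ "real (card E)"]
    using bound by (intro mult_left_mono) auto
  finally show ?thesis .
qed

text \<open>\<open>\<tau> t\<close> carries the fibre over \<open>u\<close> injectively into the
  fibre over \<open>u + t\<close>, so every fibre is at most as large as every other. Stating this
  for arbitrary shifts rather than a group action lets the length of a translation depend on the
  point, as quadrics require.\<close>

lemma (in abelian_group) card_eq_mult_card_fibre:
  assumes fin: "finite A" "finite (carrier G)"
    and \<phi>: "\<And>a. a \<in> A \<Longrightarrow> \<phi> a \<in> carrier G"
    and \<tau>: "\<And>t a. t \<in> carrier G \<Longrightarrow> a \<in> A \<Longrightarrow> \<tau> t a \<in> A"
      "\<And>t a. t \<in> carrier G \<Longrightarrow> a \<in> A \<Longrightarrow> \<phi> (\<tau> t a) = \<phi> a \<oplus> t"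
    and inj: "\<And>t. t \<in> carrier G \<Longrightarrow> inj_on (\<tau> t) A"
    and c: "c \<in> carrier G"
  shows "card A = card (carrier G) * card {a\<in>A. \<phi> a = c}"
proof -
  have le: "card {a\<in>A. \<phi> a = u} \<le> card {a\<in>A. \<phi> a = v}"
    if u: "u \<in> carrier G" and v: "v \<in> carrier G" for u v
  proof (rule card_inj_on_le[where f = "\<tau> (v \<ominus> u)"])
    show "inj_on (\<tau> (v \<ominus> u)) {a\<in>A. \<phi> a = u}"
      using inj[of "v \<ominus> u"] u v by (auto intro: inj_on_subset)
    have "u \<oplus> (v \<ominus> u) = v"
      using u v by (simp add: minus_eq a_comm[of v] r_neg2)
    then show "\<tau> (v \<ominus> u) ` {a\<in>A. \<phi> a = u} \<subseteq> {a\<in>A. \<phi> a = v}"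
      using \<tau>[of "v \<ominus> u"] u v by auto
  qed (use fin in auto)
  have "card A = (\<Sum>u\<in>carrier G. card {a\<in>A. \<phi> a = u})"
  proof -
    have "card A = card (\<Union>u\<in>carrier G. {a\<in>A. \<phi> a = u})"
      using \<phi> by (intro arg_cong[where f = card]) auto
    also have "\<dots> = (\<Sum>u\<in>carrier G. card {a\<in>A. \<phi> a = u})"
      using fin by (intro card_UN_disjoint) auto
    finally show ?thesis .
  qed
  also have "\<dots> = (\<Sum>u\<in>carrier G. card {a\<in>A. \<phi> a = c})"
    using le c by (intro sum.cong refl antisym) auto
  finally show ?thesis by simp
qed

section \<open>Finite quadratic spaces\<close>

lemma card_split:
  assumes "finite A"
  shows "real (card {y\<in>A. R y}) = real (card {y\<in>A. P y \<and> R y}) + real (card {y\<in>A. \<not> P y \<and> R y})"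
proof -
  have "card ({y\<in>A. P y \<and> R y} \<union> {y\<in>A. \<not> P y \<and> R y}) =
      card {y\<in>A. P y \<and> R y} + card {y\<in>A. \<not> P y \<and> R y}"
    using assms by (intro card_Un_disjoint) auto
  moreover have "{y\<in>A. P y \<and> R y} \<union> {y\<in>A. \<not> P y \<and> R y} = {y\<in>A. R y}" by auto
  ultimately show ?thesis by simp
qed

text \<open>\<open>axpy t x y\<close> stands for \<open>y + t x\<close>. Vector space axioms are not needed: by nondegeneracy,
  every identity between vectors can be checked after pairing with \<open>b\<close>.\<close>

locale finite_quadratic_space = field F
  for F :: "'a ring" (structure) +
  fixes V :: "'v set" and origin :: 'v and axpy :: "'a \<Rightarrow> 'v \<Rightarrow> 'v \<Rightarrow> 'v"
    and Q :: "'v \<Rightarrow> 'a" and b :: "'v \<Rightarrow> 'v \<Rightarrow> 'a"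
  assumes finite_carrier: "finite (carrier F)" and finite_V: "finite V"
    and origin_in [simp]: "origin \<in> V"
    and axpy_in [simp]: "\<lbrakk>t \<in> carrier F; x \<in> V; y \<in> V\<rbrakk> \<Longrightarrow> axpy t x y \<in> V"
    and Q_in [simp]: "x \<in> V \<Longrightarrow> Q x \<in> carrier F"
    and b_in [simp]: "\<lbrakk>x \<in> V; y \<in> V\<rbrakk> \<Longrightarrow> b x y \<in> carrier F"
    and b_sym: "\<lbrakk>x \<in> V; y \<in> V\<rbrakk> \<Longrightarrow> b x y = b y x"
    and b_origin [simp]: "x \<in> V \<Longrightarrow> b origin x = \<zero>"
    and b_axpy: "\<lbrakk>t \<in> carrier F; x \<in> V; y \<in> V; z \<in> V\<rbrakk> \<Longrightarrow> b (axpy t x y) z = b y z \<oplus> t \<otimes> b x z"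
    and Q_origin [simp]: "Q origin = \<zero>"
    and Q_axpy: "\<lbrakk>t \<in> carrier F; x \<in> V; y \<in> V\<rbrakk> \<Longrightarrow>
      Q (axpy t x y) = Q y \<oplus> t \<otimes> b x y \<oplus> t \<otimes> t \<otimes> Q x"
    and b_self: "x \<in> V \<Longrightarrow> b x x = Q x \<oplus> Q x"
    and nondegenerate: "\<lbrakk>x \<in> V; y \<in> V; \<And>z. z \<in> V \<Longrightarrow> b x z = b y z\<rbrakk> \<Longrightarrow> x = y"
begin

definition q :: real where "q = real (card (carrier F))"
definition N :: real where "N = real (card V)"
definition C :: "'v set" where "C = {x\<in>V. Q x = \<zero>}"
text \<open>The discrepancy of the quadric from its expected size. Sections of \<open>C\<close> by
  tangent hyperplanes are first computed exactly in terms of \<open>s\<close>; the bound of order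
  \<open>sqrt N\<close> on \<open>s\<close> is derived from them afterwards.\<close>

definition s :: real where "s = real (card C) - N / q"

text \<open>Says that \<open>y'\<close> is a multiple of \<open>y\<close>, tested by pairing. The
  factor may be zero, so \<open>origin\<close> depends on every vector, while among vectors of
  \<open>V\<close> only \<open>origin\<close> depends on \<open>origin\<close>.\<close>

definition dependent :: "'v \<Rightarrow> 'v \<Rightarrow> bool" where
  "dependent y y' \<longleftrightarrow> (\<exists>c\<in>carrier F. \<forall>x\<in>V. b x y' = c \<otimes> b x y)"

lemma q_ge_2: "2 \<le> q"
proof -
  have "card {\<zero>, \<one>} \<le> card (carrier F)"
    using finite_carrier by (intro card_mono) auto
  then show ?thesis by (simp add: q_def)
qed

lemma N_ge_1: "1 \<le> N"
  unfolding N_def using finite_V origin_in by (metis One_nat_def Suc_leI card_gt_0_iff empty_iff of_nat_1 of_nat_le_iff)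

lemma finite_C: "finite C"
  unfolding C_def using finite_V by simp

lemma C_subset: "C \<subseteq> V"
  unfolding C_def by auto

section \<open>Duality and the level sets of linear functionals\<close>

lemma axpy_cancel:
  assumes "t \<in> carrier F" "v \<in> V" "x \<in> V" "y \<in> V" "axpy t v x = axpy t v y"
  shows "x = y"
proof (rule nondegenerate)
  fix z assume z: "z \<in> V"
  have "b x z \<oplus> t \<otimes> b v z = b y z \<oplus> t \<otimes> b v z"
    using assms z by (metis b_axpy)
  then show "b x z = b y z" using assms z by simp
qed (use assms in auto)

lemma exists_dual_vector:
  assumes y: "y \<in> V" "y \<noteq> origin"
  shows "\<exists>v\<in>V. b v y = \<one>"
proof -
  obtain w where w: "w \<in> V" "b w y \<noteq> \<zero>"
    using nondegenerate[OF y(1) origin_in] y by (metis b_origin b_sym)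
  then have u: "b w y \<in> Units F" using y field_Units by auto
  have "b (axpy (inv (b w y)) w origin) y = \<one>"
    using u w y by (simp add: b_axpy Units_l_inv)
  then show ?thesis using u w by (intro bexI[of _ "axpy (inv (b w y)) w origin"]) auto
qed

lemma exists_separating_vector:
  assumes y: "y \<in> V" "y \<noteq> origin" "y' \<in> V" "\<not> dependent y y'"
  shows "\<exists>v\<in>V. b v y = \<zero> \<and> b v y' = \<one>"
proof -
  obtain u where u: "u \<in> V" "b u y = \<one>" using exists_dual_vector y by blast
  \<comment> \<open>As \<open>b u y = \<one>\<close>, the only candidate for the factor in
    \<open>dependent\<close> is \<open>b u y'\<close>; independence supplies an \<open>x\<close>
    refuting it. Projecting this \<open>x\<close> along \<open>u\<close> onto the hyperplane
    orthogonal to \<open>y\<close> gives \<open>w\<close>.\<close>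
  obtain x where x: "x \<in> V" "b x y' \<noteq> b u y' \<otimes> b x y"
    using y u unfolding dependent_def by (metis b_in)
  define w where "w = axpy (\<ominus> b x y) u x"
  have w: "w \<in> V" "b w y = \<zero>" "b w y' = b x y' \<oplus> \<ominus> b x y \<otimes> b u y'"
    using x u y by (auto simp: w_def b_axpy r_neg)
  have "b w y' \<noteq> \<zero>"
  proof
    assume "b w y' = \<zero>"
    then have "b x y' \<oplus> \<ominus> (b u y' \<otimes> b x y) = \<zero>"
      using w x u y by (simp add: l_minus m_comm[of "b u y'"])
    then have "\<ominus> (\<ominus> (b u y' \<otimes> b x y)) = b x y'"
      using x(1) u(1) y by (simp add: minus_equality)
    then show False using x u(1) y by simp
  qed
  then have i: "b w y' \<in> Units F" using y(3) w(1) by (simp add: field_Units)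
  have "b (axpy (inv (b w y')) w origin) y = \<zero>" "b (axpy (inv (b w y')) w origin) y' = \<one>"
    using i w(1,2) y(1,3) by (simp_all add: b_axpy Units_l_inv)
  then show ?thesis using i w(1) by (intro bexI[of _ "axpy (inv (b w y')) w origin"]) auto
qed

lemma card_level_set:
  assumes y: "y \<in> V" "y \<noteq> origin" and c: "c \<in> carrier F"
  shows "real (card {x\<in>V. b x y = c}) = N / q"
proof -
  obtain v where v: "v \<in> V" "b v y = \<one>" using exists_dual_vector y by blast
  have "card V = card (carrier F) * card {x\<in>V. b x y = c}"
  proof (rule card_eq_mult_card_fibre[where \<tau> = "\<lambda>t x. axpy t v x"])
    show "inj_on (axpy t v) V" if "t \<in> carrier F" for t
      using that v by (auto intro!: inj_onI dest: axpy_cancel)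
  qed (use v y c finite_V finite_carrier in \<open>auto simp: b_axpy\<close>)
  then show ?thesis using q_ge_2 by (simp add: q_def N_def)
qed

text \<open>Fibre a level set of the first functional over the second, translating along a vector
  that leaves the first unchanged.\<close>

lemma card_level_set2:
  assumes y: "y \<in> V" "y \<noteq> origin" "y' \<in> V" "\<not> dependent y y'"
    and c: "c \<in> carrier F" "c' \<in> carrier F"
  shows "real (card {x\<in>V. b x y = c \<and> b x y' = c'}) = N / q\<^sup>2"
proof -
  obtain v where v: "v \<in> V" "b v y = \<zero>" "b v y' = \<one>" using exists_separating_vector y by blast
  have "card {x\<in>V. b x y = c} = card (carrier F) * card {x\<in>{x\<in>V. b x y = c}. b x y' = c'}"
  proof (rule card_eq_mult_card_fibre[where \<tau> = "\<lambda>t x. axpy t v x"])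
    show "inj_on (axpy t v) {x\<in>V. b x y = c}" if "t \<in> carrier F" for t
      using that v by (auto intro!: inj_onI dest: axpy_cancel)
  qed (use v y c finite_V finite_carrier in \<open>auto simp: b_axpy\<close>)
  then have "real (card {x\<in>V. b x y = c}) = q * real (card {x\<in>V. b x y = c \<and> b x y' = c'})"
    by (simp add: q_def conj_assoc)
  then show ?thesis using card_level_set[OF y(1,2) c(1)] q_ge_2
    by (simp add: power2_eq_square field_simps)
qed

lemma card_dependent:
  assumes "y \<in> V" "G \<subseteq> V"
  shows "real (card {y'\<in>G. dependent y y'}) \<le> q"
proof -
  have "{y'\<in>G. dependent y y'} \<subseteq> (\<lambda>c. axpy c y origin) ` carrier F"
  proof
    fix y' assume "y' \<in> {y'\<in>G. dependent y y'}"
    then obtain c where c: "c \<in> carrier F" "\<forall>x\<in>V. b x y' = c \<otimes> b x y" and y': "y' \<in> V"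
      using assms unfolding dependent_def by auto
    have "y' = axpy c y origin"
    proof (rule nondegenerate)
      fix z assume "z \<in> V"
      then show "b y' z = b (axpy c y origin) z"
        using c y' assms by (simp add: b_axpy) (metis b_sym)
    qed (use c y' assms in auto)
    then show "y' \<in> (\<lambda>c. axpy c y origin) ` carrier F" using c by auto
  qed
  then show ?thesis unfolding q_def
    by (meson card_image_le card_mono finite_carrier finite_imageI le_trans of_nat_le_iff)
qed

text \<open>Translating by an isotropic \<open>x\<close> changes \<open>Q\<close> by a linear amount, so each line in direction
  \<open>x\<close> on which \<open>b x\<close> is a nonzero constant meets \<open>C\<close> exactly once.\<close>

lemma card_line_meets_C:
  assumes x: "x \<in> C"
    and inv_R: "\<And>t y. \<lbrakk>t \<in> carrier F; y \<in> V; R y\<rbrakk> \<Longrightarrow> R (axpy t x y)"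
  shows "q * real (card {y\<in>C. b x y \<noteq> \<zero> \<and> R y}) = real (card {y\<in>V. b x y \<noteq> \<zero> \<and> R y})"
proof -
  let ?A = "{y\<in>V. b x y \<noteq> \<zero> \<and> R y}"
  \<comment> \<open>As \<open>Q x = \<zero>\<close>, adding \<open>r x\<close> to \<open>y\<close>
    raises \<open>Q\<close> by \<open>r (b x y)\<close>; dividing by \<open>b x y\<close> makes the
    increase exactly \<open>t\<close>.\<close>
  let ?\<tau> = "\<lambda>t y. axpy (t \<otimes> inv (b x y)) x y"
  have xV: "x \<in> V" "Q x = \<zero>" and bxx: "b x x = \<zero>"
    using x b_self by (auto simp: C_def)
  have inverse: "inv (b x y) \<in> carrier F" "inv (b x y) \<otimes> b x y = \<one>" if "y \<in> ?A" for y
    using that xV by (auto simp: field_Units Units_l_inv)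
  have b\<tau>: "b x (axpy t x y) = b x y" if "t \<in> carrier F" "y \<in> V" for t y
  proof -
    have "b x (axpy t x y) = b (axpy t x y) x" using that xV by (simp add: b_sym)
    also have "\<dots> = b y x" using that xV bxx by (simp add: b_axpy)
    finally show ?thesis using that xV by (simp add: b_sym)
  qed
  have "card ?A = card (carrier F) * card {y\<in>?A. Q y = \<zero>}"
  proof (rule card_eq_mult_card_fibre[where \<tau> = ?\<tau>])
    show "Q (?\<tau> t y) = Q y \<oplus> t" if "t \<in> carrier F" "y \<in> ?A" for t y
      using that inverse[of y] xV by (simp add: Q_axpy m_assoc)
    show "?\<tau> t y \<in> ?A" if "t \<in> carrier F" "y \<in> ?A" for t y
      using that inverse[of y] xV inv_R by (simp add: b\<tau>)
    show "inj_on (?\<tau> t) ?A" if t: "t \<in> carrier F" for t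
    proof (rule inj_onI)
      fix y y' assume A: "y \<in> ?A" "y' \<in> ?A" and eq: "?\<tau> t y = ?\<tau> t y'"
      \<comment> \<open>The length of the step depends on \<open>y\<close> only through
        \<open>b x y\<close>, which the step preserves; points with equal images have therefore
        moved equally far.\<close>
      have "b x y = b x (?\<tau> t y)" "b x y' = b x (?\<tau> t y')"
        using A t inverse[of y] inverse[of y'] by (auto simp: b\<tau>)
      then have "b x y = b x y'" using eq by simp
      then show "y = y'" using A t inverse[of y] eq xV axpy_cancel[of "t \<otimes> inv (b x y)" x y y'] by simp
    qed
  qed (use finite_V finite_carrier in auto)
  moreover have "{y\<in>?A. Q y = \<zero>} = {y\<in>C. b x y \<noteq> \<zero> \<and> R y}" by (auto simp: C_def)
  ultimately show ?thesis by (simp add: q_def)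
qed

text \<open>Off the tangent hyperplane at \<open>x\<close>, lines in direction \<open>x\<close> give
  exactly \<open>(N - N/q)/q\<close> points of \<open>C\<close>. The whole discrepancy
  \<open>s\<close> therefore sits on the section by that hyperplane.\<close>

lemma card_C_orthogonal:
  assumes x: "x \<in> C" "x \<noteq> origin"
  shows "real (card {y\<in>C. b x y = \<zero>}) = s + N / q\<^sup>2"
proof -
  have xV: "x \<in> V" using x C_subset by auto
  have "{y\<in>V. b y x = \<zero>} = {y\<in>V. b x y = \<zero>}" using xV b_sym by auto
  then have "real (card {y\<in>V. b x y = \<zero>}) = N / q"
    using card_level_set[OF xV x(2) zero_closed] by simp
  then have "real (card {y\<in>V. b x y \<noteq> \<zero> \<and> True}) = N - N / q"
    using card_split[of V "\<lambda>_. True" "\<lambda>y. b x y = \<zero>"] finite_V by (simp add: N_def)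
  then have "q * real (card {y\<in>C. b x y \<noteq> \<zero>}) = N - N / q"
    using card_line_meets_C[OF x(1), of "\<lambda>_. True"] by simp
  then have "real (card {y\<in>C. b x y \<noteq> \<zero>}) = N / q - N / q\<^sup>2"
    using q_ge_2 by (simp add: field_simps power2_eq_square)
  then show ?thesis
    using card_split[of C "\<lambda>_. True" "\<lambda>y. b x y = \<zero>"] finite_C by (simp add: s_def)
qed

text \<open>If \<open>x\<close> and \<open>x'\<close> are orthogonal, the condition on
  \<open>x'\<close> survives translation along \<open>x\<close>, so the complementary count works
  inside it and \<open>s\<close> is passed on in full. Otherwise translation along \<open>x'\<close>
  preserves the section of \<open>C\<close> by the hyperplane of \<open>x'\<close> and moves
  \<open>b x\<close> through all scalars; the section splits into \<open>q\<close> equal parts and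
  \<open>s\<close> is divided by \<open>q\<close>.\<close>

lemma card_C_orthogonal2:
  assumes x: "x \<in> C" "x \<noteq> origin" and x': "x' \<in> C" "x' \<noteq> origin" and nd: "\<not> dependent x x'"
  shows "real (card {y\<in>C. b x y = \<zero> \<and> b x' y = \<zero>}) =
    (if b x x' = \<zero> then s + N / q ^ 3 else s / q + N / q ^ 3)"
proof (cases "b x x' = \<zero>")
  case True
  have xV: "x \<in> V" "x' \<in> V" using x x' C_subset by auto
  have level: "{y\<in>V. b y x' = \<zero>} = {y\<in>V. b x' y = \<zero>}"
    "{y\<in>V. b y x = \<zero> \<and> b y x' = \<zero>} = {y\<in>V. b x y = \<zero> \<and> b x' y = \<zero>}"
    using xV b_sym by auto
  have "real (card {y\<in>V. b x y \<noteq> \<zero> \<and> b x' y = \<zero>}) = N / q - N / q\<^sup>2"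
    using card_split[of V "\<lambda>y. b x' y = \<zero>" "\<lambda>y. b x y = \<zero>"] finite_V
      card_level_set[OF xV(2) x'(2) zero_closed] card_level_set2[OF xV(1) x(2) xV(2) nd zero_closed zero_closed]
    by (simp add: level)
  moreover have "q * real (card {y\<in>C. b x y \<noteq> \<zero> \<and> b x' y = \<zero>}) = real (card {y\<in>V. b x y \<noteq> \<zero> \<and> b x' y = \<zero>})"
  proof (rule card_line_meets_C[OF x(1)])
    fix t y assume "t \<in> carrier F" "y \<in> V" "b x' y = \<zero>"
    then have "b (axpy t x y) x' = \<zero>" using True xV by (simp add: b_axpy b_sym[of y x'])
    then show "b x' (axpy t x y) = \<zero>"
      using xV \<open>t \<in> carrier F\<close> \<open>y \<in> V\<close> by (simp add: b_sym[of x' "axpy t x y"])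
  qed
  ultimately have "real (card {y\<in>C. b x y \<noteq> \<zero> \<and> b x' y = \<zero>}) = N / q\<^sup>2 - N / q ^ 3"
    using q_ge_2 by (simp add: field_simps power2_eq_square power3_eq_cube)
  then show ?thesis
    using card_split[of C "\<lambda>y. b x' y = \<zero>" "\<lambda>y. b x y = \<zero>"] finite_C
      card_C_orthogonal[OF x'] True by (simp add: conj_commute)
next
  case False
  have xV: "x \<in> V" "x' \<in> V" "Q x = \<zero>" "Q x' = \<zero>" using x x' by (auto simp: C_def)
  have b0: "b x' x' = \<zero>" using xV b_self by auto
  \<comment> \<open>Normalises a step \<open>t k\<close> along \<open>x'\<close> so that it changes
    \<open>b x\<close> by exactly \<open>t\<close>.\<close>
  define k where "k = inv (b x x')"
  have k: "k \<in> carrier F" "k \<otimes> b x' x = \<one>"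
    using False xV by (auto simp: k_def field_Units Units_l_inv b_sym[of x' x])
  have b'\<tau>: "b x' (axpy t x' y) = b x' y" if "t \<in> carrier F" "y \<in> V" for t y
  proof -
    have "b x' (axpy t x' y) = b (axpy t x' y) x'" using that xV by (intro b_sym) auto
    also have "\<dots> = b y x'" using that xV b0 by (simp add: b_axpy)
    also have "\<dots> = b x' y" using that xV by (intro b_sym) auto
    finally show ?thesis .
  qed
  have "card {y\<in>C. b x' y = \<zero>} = card (carrier F) * card {y\<in>{y\<in>C. b x' y = \<zero>}. b x y = \<zero>}"
  proof (rule card_eq_mult_card_fibre[where \<tau> = "\<lambda>t y. axpy (t \<otimes> k) x' y"])
    show "axpy (t \<otimes> k) x' y \<in> {y\<in>C. b x' y = \<zero>}" if "t \<in> carrier F" "y \<in> {y\<in>C. b x' y = \<zero>}" for t y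
      using that k xV by (auto simp: C_def b'\<tau> Q_axpy)
    show "b x (axpy (t \<otimes> k) x' y) = b x y \<oplus> t" if "t \<in> carrier F" "y \<in> {y\<in>C. b x' y = \<zero>}" for t y
    proof -
      have "y \<in> V" using that by (simp add: C_def)
      then have "b x (axpy (t \<otimes> k) x' y) = b (axpy (t \<otimes> k) x' y) x"
        using that k xV by (intro b_sym) auto
      also have "\<dots> = b y x \<oplus> t" using that k xV \<open>y \<in> V\<close> by (simp add: b_axpy m_assoc)
      finally show ?thesis using xV \<open>y \<in> V\<close> by (simp add: b_sym[of y x])
    qed
    show "inj_on (\<lambda>y. axpy (t \<otimes> k) x' y) {y\<in>C. b x' y = \<zero>}" if "t \<in> carrier F" for t
    proof (rule inj_onI)
      fix y y' assume y: "y \<in> {y\<in>C. b x' y = \<zero>}" "y' \<in> {y\<in>C. b x' y = \<zero>}"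
        and eq: "axpy (t \<otimes> k) x' y = axpy (t \<otimes> k) x' y'"
      show "y = y'"
        by (rule axpy_cancel[OF _ _ _ _ eq]) (use y that k(1) xV(2) in \<open>simp_all add: C_def\<close>)
    qed
  qed (use finite_C finite_carrier xV C_subset in auto)
  moreover have "{y\<in>{y\<in>C. b x' y = \<zero>}. b x y = \<zero>} = {y\<in>C. b x y = \<zero> \<and> b x' y = \<zero>}" by auto
  ultimately have "s + N / q\<^sup>2 = q * real (card {y\<in>C. b x y = \<zero> \<and> b x' y = \<zero>})"
    using card_C_orthogonal[OF x'] by (simp add: q_def)
  then have "real (card {y\<in>C. b x y = \<zero> \<and> b x' y = \<zero>}) = (s + N / q\<^sup>2) / q"
    using q_ge_2 by (simp add: nonzero_eq_divide_eq mult.commute)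
  then show ?thesis
    using False by (simp add: add_divide_distrib power2_eq_square power3_eq_cube mult.assoc)
qed

end

section \<open>Incidences with a quadric\<close>

text \<open>For absorbing the incidences of the zero vector, whose number \<open>t\<close> is
  bounded both by the size of the quadric and by the trivial count \<open>T\<close>.\<close>

lemma mult_sqrt_min_ge:
  assumes "0 < L" "0 \<le> t" "t \<le> 2 * L" "t \<le> T"
  shows "t \<le> 2 * (L * sqrt_min (T / L))"
proof (cases "T / L \<le> 1")
  case True
  then have "L * sqrt_min (T / L) = T" using assms by (simp add: sqrt_min_le_1)
  then show ?thesis using assms by simp
next
  case False
  then have "1 \<le> sqrt_min (T / L)" by (simp add: sqrt_min_ge_1)
  then have "L * 1 \<le> L * sqrt_min (T / L)" using assms by (intro mult_left_mono) auto
  then show ?thesis using assms by linarith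
qed

lemma le_mult_sqrt_min:
  assumes "0 < L" "0 \<le> T" "R \<le> T" "R\<^sup>2 \<le> L * T"
  shows "R \<le> L * sqrt_min (T / L)"
proof (cases "T / L \<le> 1")
  case True
  then show ?thesis using assms by (simp add: sqrt_min_le_1)
next
  case False
  have "R \<le> sqrt (L * T)" using assms by (simp add: real_le_rsqrt)
  also have "L * T = L\<^sup>2 * (T / L)" using assms by (simp add: power2_eq_square)
  also have "sqrt (L\<^sup>2 * (T / L)) = L * sqrt (T / L)"
    using assms by (simp only: real_sqrt_mult real_sqrt_abs abs_of_pos)
  finally show ?thesis using False by (simp only: sqrt_min_ge_1)
qed

text \<open>Put \<open>u = e/W\<close> and \<open>v = g/W\<close>. If both are at most 1, the
  trivial bound \<open>b0\<close> is the product term; if both exceed 1, \<open>b1\<close> is its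
  square. In the mixed cases one takes whichever of \<open>b2\<close>, \<open>b3\<close> has its
  square on the smaller variable, since for \<open>v \<le> 1 < u\<close> the quantity
  \<open>W^4 u v^2\<close> is the square of the product term.\<close>

lemma le_of_four_bounds:
  fixes e g L W R :: real
  assumes pos: "0 \<le> e" "0 \<le> g" "0 < L" "0 < W"
    and b0: "R \<le> e * g" and b1: "R\<^sup>2 \<le> e * (W\<^sup>2 * g)"
    and b2: "R\<^sup>2 \<le> e * (L * g + 3 * W * g\<^sup>2)" and b3: "R\<^sup>2 \<le> g * (L * e + 3 * W * e\<^sup>2)"
  shows "R \<le> 2 * (L * sqrt_min (e * g / L) + W\<^sup>2 * sqrt_min (e / W) * sqrt_min (g / W))"
proof -
  define u v where "u = e / W" and "v = g / W"
  have uv: "e = W * u" "g = W * v" "0 \<le> u" "0 \<le> v" using pos by (auto simp: u_def v_def)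
  let ?M = "sqrt_min u * sqrt_min v"
  have M: "0 \<le> ?M" using uv by (simp add: sqrt_min_nonneg)
  have key: "R \<le> sqrt (L * (e * g)) + 2 * (W\<^sup>2 * ?M)"
  proof -
    have split: "R \<le> sqrt (L * (e * g)) + 2 * (W\<^sup>2 * (sqrt x * y))"
      if "0 \<le> x" "0 \<le> y" "R\<^sup>2 \<le> L * (e * g) + 3 * (W^4 * (x * y\<^sup>2))" for x y
    proof -
      have "R \<le> sqrt (L * (e * g) + 3 * (W^4 * (x * y\<^sup>2)))" using that by (simp add: real_le_rsqrt)
      also have "\<dots> \<le> sqrt (L * (e * g)) + sqrt (3 * (W^4 * (x * y\<^sup>2)))"
        using that pos by (intro sqrt_add_le_add_sqrt) auto
      \<comment> \<open>\<open>sqrt 3\<close> is rounded up to 2.\<close>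
      also have "sqrt (3 * (W^4 * (x * y\<^sup>2))) \<le> sqrt ((2 * (W\<^sup>2 * (sqrt x * y)))\<^sup>2)"
        using that by (intro real_sqrt_le_mono) (simp add: power_mult_distrib mult_right_mono)
      also have "\<dots> = 2 * (W\<^sup>2 * (sqrt x * y))"
        unfolding real_sqrt_abs using that by (intro abs_of_nonneg) simp
      finally show ?thesis by simp
    qed
    have small: ?thesis if "R \<le> W\<^sup>2 * ?M"
    proof -
      have "0 \<le> sqrt (L * (e * g))" "0 \<le> W\<^sup>2 * ?M" using pos M by auto
      then show ?thesis using that by linarith
    qed
    show ?thesis
    proof (cases "u \<le> 1"; cases "v \<le> 1")
      assume "u \<le> 1" "v \<le> 1"
      then have "R \<le> W\<^sup>2 * ?M" using b0 uv by (simp add: sqrt_min_le_1 power2_eq_square mult_ac)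
      then show ?thesis by (rule small)
    next
      assume a: "\<not> u \<le> 1" "\<not> v \<le> 1"
      have "R\<^sup>2 \<le> W^4 * (u * v)" using b1 uv by (simp add: power2_eq_square power4_eq_xxxx mult_ac)
      then have "R \<le> sqrt (W^4 * (u * v))" by (simp add: real_le_rsqrt)
      also have "W ^ 4 = (W\<^sup>2)\<^sup>2" by simp
      also have "sqrt ((W\<^sup>2)\<^sup>2 * (u * v)) = W\<^sup>2 * ?M"
        using a by (simp only: real_sqrt_mult real_sqrt_abs) (simp add: sqrt_min_ge_1)
      finally show ?thesis by (rule small)
    next
      assume a: "\<not> u \<le> 1" "v \<le> 1"
      then show ?thesis using split[of u v] b2 uv
        by (simp add: sqrt_min_ge_1 sqrt_min_le_1 power2_eq_square power4_eq_xxxx algebra_simps)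
    next
      assume a: "u \<le> 1" "\<not> v \<le> 1"
      then show ?thesis using split[of v u] b3 uv
        by (simp add: sqrt_min_ge_1 sqrt_min_le_1 power2_eq_square power4_eq_xxxx algebra_simps)
    qed
  qed
  have MW: "0 \<le> W\<^sup>2 * ?M" using M by simp
  show ?thesis
  \<comment> \<open>Below the crossing point \<open>e g = L\<close> the trivial bound by itself is
    the first term; above it, \<open>sqrt (L e g)\<close> is.\<close>
  proof (cases "e * g / L \<le> 1")
    case True
    then have "L * sqrt_min (e * g / L) = e * g" using pos by (simp add: sqrt_min_le_1)
    moreover have "0 \<le> e * g" using pos by simp
    ultimately show ?thesis using b0 MW unfolding u_def v_def by (simp add: mult.assoc)
  next
    case False
    have "L * (e * g) = L\<^sup>2 * (e * g / L)" using pos by (simp add: power2_eq_square)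
    then have "sqrt (L * (e * g)) = L * sqrt_min (e * g / L)"
      using False pos by (simp only: real_sqrt_mult sqrt_min_ge_1) (simp add: sqrt_min_ge_1)
    moreover have "0 \<le> sqrt (L * (e * g))" using pos by simp
    ultimately show ?thesis using key unfolding u_def v_def by (simp add: mult.assoc)
  qed
qed

lemma incidences_Un_left:
  assumes "finite E" "finite E'" "E \<inter> E' = {}"
  shows "incidences P (E \<union> E') G = incidences P E G + incidences P E' G"
  unfolding incidences_def using assms by (rule sum.union_disjoint)

lemma incidences_Un_right:
  assumes "finite G" "finite G'" "G \<inter> G' = {}"
  shows "incidences P E (G \<union> G') = incidences P E G + incidences P E G'"
  using incidences_Un_left[OF assms, of "\<lambda>y x. P x y" E]
  unfolding incidences_swap[of P E] .

section \<open>Second moments over the space and over the quadric, and the incidence bound they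
  give\<close>

context finite_quadratic_space
begin

text \<open>A Gram matrix estimate by rows: a row has at most \<open>q\<close> dependent entries, so
  the excess \<open>a\<close> is paid at most \<open>q\<close> times in each row and
  \<open>c\<close> everywhere.\<close>

lemma pair_sum_le:
  assumes G: "G \<subseteq> V" and a: "0 \<le> a"
    and entry: "\<And>y y'. \<lbrakk>y \<in> G; y' \<in> G\<rbrakk> \<Longrightarrow> k y y' \<le> a * of_bool (dependent y y') + c"
  shows "(\<Sum>y\<in>G. \<Sum>y'\<in>G. k y y') \<le> a * q * real (card G) + c * (real (card G))\<^sup>2"
proof -
  have fin: "finite G" using G finite_V finite_subset by auto
  have "(\<Sum>y\<in>G. \<Sum>y'\<in>G. k y y') \<le> (\<Sum>y\<in>G. a * q + c * real (card G))"
  proof (rule sum_mono)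
    fix y assume y: "y \<in> G"
    have "(\<Sum>y'\<in>G. k y y') \<le> (\<Sum>y'\<in>G. a * of_bool (dependent y y') + c)"
      using entry y by (intro sum_mono)
    also have "\<dots> = a * real (card {y'\<in>G. dependent y y'}) + c * real (card G)"
      unfolding card_conv_sum_of_bool[OF fin] by (simp only: sum.distrib sum_distrib_left[symmetric]) simp
    also have "\<dots> \<le> a * q + c * real (card G)"
      using card_dependent[of y G] y G a by (intro add_right_mono mult_left_mono) auto
    finally show "(\<Sum>y'\<in>G. k y y') \<le> a * q + c * real (card G)" .
  qed
  then show ?thesis by (simp add: algebra_simps power2_eq_square)
qed

text \<open>Independent \<open>y\<close>, \<open>y'\<close> are exactly uncorrelated, as
  \<open>N/q^2 - 2 N/q^2 + N/q^2 = 0\<close>. Dependent pairs cost at most \<open>N/q\<close> each,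
  and up to \<open>q\<close> of them in a row produce \<open>N\<close> where the affine relation has
  \<open>N/q\<close>.\<close>

lemma orthogonal_incidences:
  assumes E: "E \<subseteq> V" and G: "G \<subseteq> V - {origin}"
  shows "(incidences (\<lambda>x y. b x y = \<zero>) E G - real (card E) * real (card G) / q)\<^sup>2
    \<le> real (card E) * (N * real (card G))"
proof (rule incidences_deviation[OF finite_V _ E])
  show "finite G" using G finite_V finite_subset by blast
  have "(\<Sum>y\<in>G. \<Sum>y'\<in>G. real (card {x\<in>V. b x y = \<zero> \<and> b x y' = \<zero>}) - real (card {x\<in>V. b x y = \<zero>}) / q
       - real (card {x\<in>V. b x y' = \<zero>}) / q + real (card V) / q\<^sup>2)
      \<le> N / q * q * real (card G) + 0 * (real (card G))\<^sup>2"
  proof (rule pair_sum_le)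
    fix y y' assume "y \<in> G" "y' \<in> G"
    then have y: "y \<in> V" "y \<noteq> origin" "y' \<in> V" "y' \<noteq> origin" using G by auto
    have "real (card {x\<in>V. b x y = \<zero> \<and> b x y' = \<zero>}) \<le> real (card {x\<in>V. b x y = \<zero>})"
      using finite_V by (intro of_nat_mono card_mono) auto
    moreover have "0 \<le> N / q\<^sup>2" using N_ge_1 by simp
    ultimately show "real (card {x\<in>V. b x y = \<zero> \<and> b x y' = \<zero>}) - real (card {x\<in>V. b x y = \<zero>}) / q
       - real (card {x\<in>V. b x y' = \<zero>}) / q + real (card V) / q\<^sup>2
      \<le> N / q * of_bool (dependent y y') + 0"
      using y card_level_set2[OF y(1-3)] by (simp add: card_level_set N_def[symmetric] power2_eq_square)
  qed (use G N_ge_1 q_ge_2 in auto)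
  then show "(\<Sum>y\<in>G. \<Sum>y'\<in>G. real (card {x\<in>V. b x y = \<zero> \<and> b x y' = \<zero>}) - real (card {x\<in>V. b x y = \<zero>}) / q
       - real (card {x\<in>V. b x y' = \<zero>}) / q + real (card V) / q\<^sup>2) \<le> N * real (card G)"
    using q_ge_2 by simp
qed

text \<open>For distinct dependent \<open>y\<close>, \<open>y'\<close> the hyperplanes
  \<open>b x y = \<one>\<close> and \<open>b x y' = \<one>\<close> are disjoint, so their entry is
  negative; independent pairs have entry zero. Only the diagonal is left to pay for.\<close>

lemma affine_incidences:
  assumes E: "E \<subseteq> V" and G: "G \<subseteq> V - {origin}"
  shows "(incidences (\<lambda>x y. b x y = \<one>) E G - real (card E) * real (card G) / q)\<^sup>2
    \<le> real (card E) * (N / q * real (card G))"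
proof (rule incidences_deviation[OF finite_V _ E])
  show fin: "finite G" using G finite_V finite_subset by blast
  have entry: "real (card {x\<in>V. b x y = \<one> \<and> b x y' = \<one>}) - real (card {x\<in>V. b x y = \<one>}) / q
       - real (card {x\<in>V. b x y' = \<one>}) / q + real (card V) / q\<^sup>2 \<le> N / q * of_bool (y' = y)"
    if "y \<in> G" "y' \<in> G" for y y'
  proof -
    have y: "y \<in> V" "y \<noteq> origin" "y' \<in> V" "y' \<noteq> origin" using that G by auto
    have nonneg: "0 \<le> N / q\<^sup>2" using N_ge_1 by simp
    consider "y' = y" | "\<not> dependent y y'" | "dependent y y'" "y' \<noteq> y" by blast
    then show ?thesis
    proof cases
      case 1
      then show ?thesis using y nonneg by (simp add: card_level_set N_def[symmetric] power2_eq_square)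
    next
      case 2
      then show ?thesis using y nonneg N_ge_1 q_ge_2 card_level_set2[OF y(1-3)]
        by (simp add: card_level_set N_def[symmetric] power2_eq_square)
    next
      case 3
      then obtain c where c: "c \<in> carrier F" "\<And>x. x \<in> V \<Longrightarrow> b x y' = c \<otimes> b x y"
        unfolding dependent_def by auto
      have "{x\<in>V. b x y = \<one> \<and> b x y' = \<one>} = {}"
      proof (rule ccontr)
        assume "{x\<in>V. b x y = \<one> \<and> b x y' = \<one>} \<noteq> {}"
        then have "c = \<one>" using c by force
        then have "b y' x = b y x" if "x \<in> V" for x
          using c(2)[OF that] that y by (simp add: b_sym[of y'] b_sym[of y])
        then show False using 3 y nondegenerate by blast
      qed
      then have "card {x\<in>V. b x y = \<one> \<and> b x y' = \<one>} = 0" by (simp only: card.empty)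
      then show ?thesis using 3 y nonneg by (simp add: card_level_set N_def[symmetric] power2_eq_square)
    qed
  qed
  have "(\<Sum>y\<in>G. \<Sum>y'\<in>G. real (card {x\<in>V. b x y = \<one> \<and> b x y' = \<one>}) - real (card {x\<in>V. b x y = \<one>}) / q
       - real (card {x\<in>V. b x y' = \<one>}) / q + real (card V) / q\<^sup>2)
      \<le> (\<Sum>y\<in>G. \<Sum>y'\<in>G. N / q * of_bool (y' = y))"
    by (intro sum_mono entry)
  also have "\<dots> = (\<Sum>y\<in>G. N / q * real (card {y'\<in>G. y' = y}))"
    unfolding card_conv_sum_of_bool[OF fin] by (simp only: sum_distrib_left)
  also have "\<dots> = (\<Sum>y\<in>G. N / q)"
  proof (intro sum.cong refl)
    fix y assume "y \<in> G"
    then have "{y'\<in>G. y' = y} = {y}" by auto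
    then show "N / q * real (card {y'\<in>G. y' = y}) = N / q" by simp
  qed
  finally show "(\<Sum>y\<in>G. \<Sum>y'\<in>G. real (card {x\<in>V. b x y = \<one> \<and> b x y' = \<one>}) - real (card {x\<in>V. b x y = \<one>}) / q
       - real (card {x\<in>V. b x y' = \<one>}) / q + real (card V) / q\<^sup>2) \<le> N / q * real (card G)"
    by (simp add: mult.commute)
qed

lemma orthogonal_C_card:
  assumes "x \<in> C" "x \<noteq> origin"
  shows "real (card {y\<in>C. b y x = \<zero>}) = s + N / q\<^sup>2"
proof -
  have "{y\<in>C. b y x = \<zero>} = {y\<in>C. b x y = \<zero>}" using assms b_sym by (auto simp: C_def)
  then show ?thesis using card_C_orthogonal[OF assms] by simp
qed

text \<open>The size of the quadric comes for free: \<open>C\<close> against itself is a regular incidence structure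
  whose degree is a function of \<open>s\<close>.\<close>

lemma abs_s_le:
  assumes "\<exists>x\<in>C. x \<noteq> origin"
  shows "\<bar>s\<bar> \<le> 3 * sqrt N"
proof -
  let ?C = "C - {origin}"
  define c where "c = real (card ?C)"
  have "origin \<in> C" by (simp add: C_def)
  then have cC: "real (card C) = c + 1"
    unfolding c_def using finite_C by (metis card.remove of_nat_Suc add.commute)
  have "card ?C > 0" using assms finite_C by (auto simp: card_gt_0_iff)
  then have c1: "1 \<le> c" unfolding c_def by simp
  have "incidences (\<lambda>x y. b x y = \<zero>) C ?C = (\<Sum>y\<in>?C. real (card {x\<in>C. b x y = \<zero>}))"
    unfolding incidences_def card_conv_sum_of_bool[OF finite_C] by (rule sum.swap)
  also have "\<dots> = c * (s + N / q\<^sup>2)" by (simp add: orthogonal_C_card c_def)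
  finally have I: "incidences (\<lambda>x y. b x y = \<zero>) C ?C = c * (s + N / q\<^sup>2)" .
  have "(c * (s + N / q\<^sup>2) - (c + 1) * c / q)\<^sup>2 \<le> (c + 1) * (N * c)"
    using orthogonal_incidences[of C ?C] C_subset I cC by (auto simp: c_def[symmetric])
  \<comment> \<open>Each \<open>y\<close> has a degree that differs from its expected share
    \<open>(c + 1)/q\<close> by the same amount \<open>s (1 - 1/q)\<close>, so nothing cancels and
    the deviation bound is a bound on \<open>s\<close>.\<close>
  moreover have "c * (s + N / q\<^sup>2) - (c + 1) * c / q = c * (s * (1 - 1 / q))"
  proof -
    have "c + 1 = s + N / q" using cC by (simp add: s_def)
    then have "(c + 1) * c / q = c * (s / q + N / q\<^sup>2)" by (simp add: power2_eq_square add_divide_distrib algebra_simps)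
    then show ?thesis by (simp add: algebra_simps)
  qed
  ultimately have "c\<^sup>2 * (s * (1 - 1 / q))\<^sup>2 \<le> (c + 1) * (N * c)" by (simp add: power_mult_distrib)
  also have "\<dots> \<le> (2 * c) * (N * c)" using c1 N_ge_1 by (intro mult_right_mono) auto
  also have "\<dots> = c\<^sup>2 * (2 * N)" by (simp add: power2_eq_square)
  finally have s1: "(s * (1 - 1 / q))\<^sup>2 \<le> 2 * N" using c1 by simp
  \<comment> \<open>\<open>q \<ge> 2\<close> costs a factor 4 in the square:
    \<open>s^2 \<le> 8 N\<close>, rounded up to \<open>9 N\<close>.\<close>
  have "1 / 2 \<le> 1 - 1 / q" using q_ge_2 by (simp add: field_simps)
  then have "\<bar>s\<bar> * (1 / 2) \<le> \<bar>s\<bar> * \<bar>1 - 1 / q\<bar>" by (intro mult_left_mono) auto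
  then have "(\<bar>s\<bar> * (1/2))\<^sup>2 \<le> (\<bar>s\<bar> * \<bar>1 - 1 / q\<bar>)\<^sup>2" by (intro power_mono) auto
  also have "\<dots> = (s * (1 - 1 / q))\<^sup>2" by (simp add: power_mult_distrib)
  finally have "\<bar>s\<bar>\<^sup>2 \<le> 8 * N" using s1 by (simp add: power_mult_distrib power_divide)
  also have "\<dots> \<le> (3 * sqrt N)\<^sup>2" using N_ge_1 by (simp add: power_mult_distrib)
  finally show ?thesis by (rule power2_le_imp_le) (use N_ge_1 in auto)
qed

text \<open>A tangent section has \<open>s + N/q^2\<close> points and lies in a hyperplane of
  \<open>N/q\<close> points. This avoids comparing \<open>sqrt N\<close> with \<open>N/q\<close>,
  which a proof from \<open>abs_s_le\<close> would require.\<close>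

lemma card_C_le: 
  assumes "\<exists>x\<in>C. x \<noteq> origin"
  shows "real (card C) \<le> 2 * (N / q)"
proof -
  obtain x where x: "x \<in> C" "x \<noteq> origin" using assms by auto
  then have xV: "x \<in> V" using C_subset by auto
  have "real (card {y\<in>C. b y x = \<zero>}) \<le> real (card {y\<in>V. b y x = \<zero>})"
    using finite_V C_subset by (intro of_nat_mono card_mono) auto
  then have "s + N / q\<^sup>2 \<le> N / q"
    using orthogonal_C_card[OF x] card_level_set[OF xV x(2) zero_closed] by simp
  moreover have "0 \<le> N / q\<^sup>2" using N_ge_1 by simp
  ultimately show ?thesis by (simp add: s_def)
qed

text \<open>A tangent section cannot have negative size, which bounds \<open>s\<close> from below by
  \<open>- N/q^2\<close>; \<open>q \<ge> 2\<close> then gives the factor one half.\<close>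

lemma card_C_ge: 
  assumes "\<exists>x\<in>C. x \<noteq> origin"
  shows "N / q / 2 \<le> real (card C)"
proof -
  obtain x where x: "x \<in> C" "x \<noteq> origin" using assms by auto
  have "0 \<le> s + N / q\<^sup>2" using orthogonal_C_card[OF x] by (metis of_nat_0_le_iff)
  moreover have "N / q\<^sup>2 \<le> N / q / 2"
    using q_ge_2 N_ge_1 by (simp add: power2_eq_square frac_le)
  ultimately show ?thesis by (simp add: s_def)
qed

text \<open>With the pair counts on \<open>C\<close> the terms in \<open>N\<close> cancel for
  independent pairs, leaving \<open>s\<close> times \<open>(1 - 1/q)^2\<close> or
  \<open>- (1/q) (1 - 1/q)\<close>, both of absolute value at most 1. Dependent pairs cost a further
  \<open>N/q^2\<close>, which is a factor \<open>q\<close> less than over the whole space.\<close>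

lemma orthogonal_incidences_C:
  assumes E: "E \<subseteq> C" and G: "G \<subseteq> C - {origin}"
  shows "(incidences (\<lambda>x y. b x y = \<zero>) E G - real (card E) * real (card G) / q)\<^sup>2
    \<le> real (card E) * (N / q * real (card G) + 3 * sqrt N * (real (card G))\<^sup>2)"
\<comment> \<open>\<open>abs_s_le\<close> asks for a nonzero isotropic vector; a nonempty
  \<open>G\<close> contains one.\<close>
proof (cases "G = {}")
  case True
  then show ?thesis by (simp add: incidences_def)
next
  case False
  then have s: "\<bar>s\<bar> \<le> 3 * sqrt N" using abs_s_le G by blast
  show ?thesis
  proof (rule incidences_deviation[OF finite_C _ E])
    show "finite G" using G finite_C finite_subset by blast
    have "(\<Sum>y\<in>G. \<Sum>y'\<in>G. real (card {x\<in>C. b x y = \<zero> \<and> b x y' = \<zero>}) - real (card {x\<in>C. b x y = \<zero>}) / q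
         - real (card {x\<in>C. b x y' = \<zero>}) / q + real (card C) / q\<^sup>2)
        \<le> N / q\<^sup>2 * q * real (card G) + (3 * sqrt N) * (real (card G))\<^sup>2"
    proof (rule pair_sum_le)
      fix y y' assume "y \<in> G" "y' \<in> G"
      then have y: "y \<in> C" "y \<noteq> origin" "y' \<in> C" "y' \<noteq> origin" using G by auto
      define k where "k = real (card {x\<in>C. b x y = \<zero> \<and> b x y' = \<zero>})"
      define p where "p = 1 / q"
      have p: "0 \<le> p" "p \<le> 1" using q_ge_2 by (auto simp: p_def)
      have eq: "k - real (card {x\<in>C. b x y = \<zero>}) / q - real (card {x\<in>C. b x y' = \<zero>}) / q + real (card C) / q\<^sup>2
          = k - N * p ^ 3 - 2 * (s * p) + s * p\<^sup>2"
      proof -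
        have "real (card C) = s + N / q" by (simp add: s_def)
        then show ?thesis
          unfolding orthogonal_C_card[OF y(1,2)] orthogonal_C_card[OF y(3,4)]
          by (simp add: p_def power2_eq_square power3_eq_cube add_divide_distrib)
      qed
      have sp: "s * r \<le> \<bar>s\<bar>" if "\<bar>r\<bar> \<le> 1" for r
        using mult_left_mono[OF that, of "\<bar>s\<bar>"] abs_ge_self[of "s * r"] by (simp add: abs_mult)
      have pp: "0 \<le> p * (1 - p)" "p * (1 - p) \<le> 1" "0 \<le> (1 - p)\<^sup>2" "(1 - p)\<^sup>2 \<le> 1"
        using p by (auto simp: mult_le_one power_le_one)
      have "k - N * p ^ 3 - 2 * (s * p) + s * p\<^sup>2 \<le> N * p\<^sup>2 * of_bool (dependent y y') + \<bar>s\<bar>"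
      proof (cases "dependent y y'")
        case True
        have "k \<le> real (card {x\<in>C. b x y = \<zero>})"
          unfolding k_def using finite_C by (intro of_nat_mono card_mono) auto
        then have "k \<le> s + N * p\<^sup>2" using orthogonal_C_card[OF y(1,2)] by (simp add: p_def power_divide)
        moreover have "0 \<le> N * p ^ 3" using p N_ge_1 by simp
        moreover have "s - 2 * (s * p) + s * p\<^sup>2 = s * (1 - p)\<^sup>2"
          by (simp add: power2_eq_square algebra_simps)
        ultimately show ?thesis using True sp[of "(1 - p)\<^sup>2"] pp by simp
      next
        case False
        have "{x\<in>C. b x y = \<zero> \<and> b x y' = \<zero>} = {x\<in>C. b y x = \<zero> \<and> b y' x = \<zero>}"
          using y b_sym by (auto simp: C_def)
        then have "k = (if b y y' = \<zero> then s + N * p ^ 3 else s * p + N * p ^ 3)"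
          unfolding k_def using card_C_orthogonal2[OF y False] by (simp add: p_def power_divide)
        moreover have "s - 2 * (s * p) + s * p\<^sup>2 = s * (1 - p)\<^sup>2" "s * p - 2 * (s * p) + s * p\<^sup>2 = s * (- (p * (1 - p)))"
          by (simp_all add: power2_eq_square algebra_simps)
        ultimately show ?thesis
          using False sp[of "(1 - p)\<^sup>2"] sp[of "- (p * (1 - p))"] pp by (auto split: if_splits)
      qed
      then show "real (card {x\<in>C. b x y = \<zero> \<and> b x y' = \<zero>}) - real (card {x\<in>C. b x y = \<zero>}) / q
         - real (card {x\<in>C. b x y' = \<zero>}) / q + real (card C) / q\<^sup>2 \<le> N / q\<^sup>2 * of_bool (dependent y y') + 3 * sqrt N"
        unfolding k_def[symmetric] eq using s by (simp add: p_def power_divide)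
    qed (use G N_ge_1 C_subset in auto)
    then show "(\<Sum>y\<in>G. \<Sum>y'\<in>G. real (card {x\<in>C. b x y = \<zero> \<and> b x y' = \<zero>}) - real (card {x\<in>C. b x y = \<zero>}) / q
         - real (card {x\<in>C. b x y' = \<zero>}) / q + real (card C) / q\<^sup>2)
        \<le> N / q * real (card G) + 3 * sqrt N * (real (card G))\<^sup>2"
      using q_ge_2 by (simp add: power2_eq_square)
  qed
qed

text \<open>\<open>(sqrt N)\<^sup>2\<close> is left unevaluated so that this is literally the
  expression in \<open>le_of_four_bounds\<close> and \<open>incidence_controlled\<close> with
  \<open>L = N / q\<close> and \<open>W = sqrt N\<close>.\<close>

definition incidence_bound :: "real \<Rightarrow> real \<Rightarrow> real" where
  "incidence_bound e g = N / q * sqrt_min (e * g / (N / q))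
     + (sqrt N)\<^sup>2 * sqrt_min (e / sqrt N) * sqrt_min (g / sqrt N)"

lemma isotropic_incidences_le:
  assumes E: "E \<subseteq> C - {origin}" and G: "G \<subseteq> C - {origin}"
  shows "incidences (\<lambda>x y. b x y = \<zero>) E G
    \<le> real (card E) * real (card G) / q + 2 * incidence_bound (real (card E)) (real (card G))"
proof -
  let ?I = "incidences (\<lambda>x y. b x y = \<zero>) E G"
  let ?e = "real (card E)" and ?g = "real (card G)"
  \<comment> \<open>Symmetry of \<open>b\<close> allows the two sets to be exchanged, which yields
    the second of the two bounds over \<open>C\<close>.\<close>
  have "?I = incidences (\<lambda>y x. b x y = \<zero>) G E" by (rule incidences_swap)
  also have "\<dots> = incidences (\<lambda>y x. b y x = \<zero>) G E"
    unfolding incidences_def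
  proof (intro sum.cong refl)
    fix y x assume "y \<in> G" "x \<in> E"
    then have "x \<in> V" "y \<in> V" using E G C_subset by auto
    then show "of_bool (b x y = \<zero>) = (of_bool (b y x = \<zero>) :: real)" by (simp add: b_sym[of x y])
  qed
  finally have swap: "?I = incidences (\<lambda>x y. b x y = \<zero>) G E" .
  have pos: "0 < q" "0 < N" using q_ge_2 N_ge_1 by auto
  have "?I - ?e * ?g / q \<le> 2 * incidence_bound ?e ?g"
    unfolding incidence_bound_def
  proof (rule le_of_four_bounds)
    have "0 \<le> ?e * ?g / q" using pos by simp
    then show "?I - ?e * ?g / q \<le> ?e * ?g" using incidences_le_card_mult[of "\<lambda>x y. b x y = \<zero>" E G] by linarith
    show "(?I - ?e * ?g / q)\<^sup>2 \<le> ?e * ((sqrt N)\<^sup>2 * ?g)"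
    proof -
      have "E \<subseteq> V" "G \<subseteq> V - {origin}" using E G C_subset by auto
      from orthogonal_incidences[OF this] show ?thesis using pos by simp
    qed
    show "(?I - ?e * ?g / q)\<^sup>2 \<le> ?e * (N / q * ?g + 3 * sqrt N * ?g\<^sup>2)"
      using E by (intro orthogonal_incidences_C G) auto
    show "(?I - ?e * ?g / q)\<^sup>2 \<le> ?g * (N / q * ?e + 3 * sqrt N * ?e\<^sup>2)"
    proof -
      have "G \<subseteq> C" using G by auto
      from orthogonal_incidences_C[OF this E] show ?thesis unfolding swap mult.commute[of ?e ?g] .
    qed
  qed (use pos in auto)
  then show ?thesis by simp
qed

text \<open>The inversion \<open>x \<mapsto> x / Q x\<close> turns the relation \<open>Q x = b x y\<close> into \<open>b x y = 1\<close>.\<close>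

lemma anisotropic_incidences_le:
  assumes E: "E \<subseteq> V - C" and G: "G \<subseteq> V - {origin}"
  shows "incidences (\<lambda>x y. Q x = b x y) E G
    \<le> real (card E) * real (card G) / q + N / q * sqrt_min (real (card E) * real (card G) / (N / q))"
proof -
  define inversion where "inversion x = axpy (inv (Q x)) x origin" for x
  have Qi: "inv (Q x) \<in> carrier F" "inv (Q x) \<otimes> Q x = \<one>" "Q x \<otimes> inv (Q x) = \<one>" "x \<in> V" if "x \<in> E" for x
  proof -
    have "x \<in> V" "Q x \<noteq> \<zero>" using that E by (auto simp: C_def)
    moreover from this have "Q x \<in> Units F" by (simp add: field_Units)
    ultimately show "inv (Q x) \<in> carrier F" "inv (Q x) \<otimes> Q x = \<one>" "Q x \<otimes> inv (Q x) = \<one>" "x \<in> V"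
      by (simp_all add: Units_l_inv Units_r_inv)
  qed
  have b_inversion: "b (inversion x) z = inv (Q x) \<otimes> b x z" if "x \<in> E" "z \<in> V" for x z
    using that Qi[OF that(1)] by (simp add: inversion_def b_axpy)
  have Q_inversion: "Q (inversion x) = inv (Q x)" if "x \<in> E" for x
  proof -
    have "b x origin = \<zero>" using Qi[OF that] by (simp add: b_sym[of x])
    then show ?thesis using Qi[OF that] by (simp add: inversion_def Q_axpy m_assoc)
  qed
  \<comment> \<open>\<open>Q\<close> of the image is \<open>1 / Q x\<close>, so the image determines
    the scalar by which \<open>x\<close> was divided.\<close>
  have inj: "inj_on inversion E"
  proof (rule inj_onI)
    fix x x' assume x: "x \<in> E" "x' \<in> E" and eq: "inversion x = inversion x'"
    have "inv (Q x) = inv (Q x')" using eq Q_inversion x by metis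
    then have "Q x = Q x'" using Qi[OF x(1)] Qi[OF x(2)]
      by (metis Q_in l_one m_assoc r_one)
    show "x = x'"
    proof (rule nondegenerate)
      fix z assume z: "z \<in> V"
      have "inv (Q x) \<otimes> b x z = inv (Q x) \<otimes> b x' z"
        using b_inversion[OF x(1) z] b_inversion[OF x(2) z] eq \<open>inv (Q x) = inv (Q x')\<close> by simp
      then have "Q x \<otimes> inv (Q x) \<otimes> b x z = Q x \<otimes> inv (Q x) \<otimes> b x' z"
        using Qi(1,4)[OF x(1)] Qi(4)[OF x(2)] z by (simp add: m_assoc)
      then show "b x z = b x' z" using Qi[OF x(1)] Qi(4)[OF x(2)] z by simp
    qed (use Qi x in auto)
  qed
  have "incidences (\<lambda>x y. Q x = b x y) E G = (\<Sum>x\<in>E. \<Sum>y\<in>G. of_bool (b (inversion x) y = \<one>))"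
    unfolding incidences_def
  proof (intro sum.cong refl arg_cong[where f = of_bool])
    fix x y assume x: "x \<in> E" and "y \<in> G"
    then have y: "y \<in> V" using G by auto
    show "(Q x = b x y) = (b (inversion x) y = \<one>)"
      using Qi[OF x] y b_inversion[OF x y] by (metis Q_in b_in l_one m_assoc r_one)
  qed
  also have "\<dots> = incidences (\<lambda>x y. b x y = \<one>) (inversion ` E) G"
    unfolding incidences_def by (simp add: sum.reindex[OF inj])
  finally have I: "incidences (\<lambda>x y. Q x = b x y) E G = incidences (\<lambda>x y. b x y = \<one>) (inversion ` E) G" .
  let ?e = "real (card E)" and ?g = "real (card G)"
  have sub: "inversion ` E \<subseteq> V" using Qi by (auto simp: inversion_def)
  have pos: "0 < q" "0 < N" using q_ge_2 N_ge_1 by auto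
  have "incidences (\<lambda>x y. Q x = b x y) E G - ?e * ?g / q \<le> N / q * sqrt_min (?e * ?g / (N / q))"
  proof (rule le_mult_sqrt_min)
    have "0 \<le> ?e * ?g / q" using pos by simp
    then show "incidences (\<lambda>x y. Q x = b x y) E G - ?e * ?g / q \<le> ?e * ?g"
      using incidences_le_card_mult[of "\<lambda>x y. Q x = b x y" E G] by linarith
    show "(incidences (\<lambda>x y. Q x = b x y) E G - ?e * ?g / q)\<^sup>2 \<le> N / q * (?e * ?g)"
      using affine_incidences[OF sub G] unfolding I card_image[OF inj] by (simp add: mult_ac)
  qed (use pos in auto)
  then show ?thesis by simp
qed

text \<open>\<open>G\<close> is split at the zero vector, \<open>E\<close> into the zero vector, the
  rest of \<open>C\<close>, and the complement of \<open>C\<close>. The zero vector on either side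
  is incident only to points of \<open>C\<close>, and \<open>card C \<le> 2 N/q\<close> lets the
  \<open>L\<close> term absorb these; the other two pieces are the isotropic and the anisotropic
  bound.\<close>

theorem incidences_le:
  assumes nontrivial: "\<exists>x\<in>C. x \<noteq> origin" and E: "E \<subseteq> V" and G: "G \<subseteq> C"
  shows "incidences (\<lambda>x y. Q x = b x y) E G
    \<le> 2 / q * real (card E) * real (card G) + 7 * incidence_bound (real (card E)) (real (card G))"
proof -
  let ?P = "\<lambda>x y. Q x = b x y"
  let ?L = "N / q"
  let ?e = "real (card E)" and ?g = "real (card G)"
  have pos: "0 < q" "0 < N" "0 < ?L" using q_ge_2 N_ge_1 by auto
  have fin: "finite E" "finite G" using E G finite_V finite_C finite_subset by blast+
  define X where "X = ?L * sqrt_min (?e * ?g / ?L)"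
  have B: "X \<le> incidence_bound ?e ?g" unfolding X_def incidence_bound_def using pos by (simp add: sqrt_min_nonneg)
  have mono: "?L * sqrt_min (e * g / ?L) \<le> X" "incidence_bound e g \<le> incidence_bound ?e ?g"
    "e * g / q \<le> ?e * ?g / q"
    if "0 \<le> e" "e \<le> ?e" "0 \<le> g" "g \<le> ?g" for e g
  proof -
    have eg: "e * g \<le> ?e * ?g" using that by (intro mult_mono) auto
    show "?L * sqrt_min (e * g / ?L) \<le> X"
      unfolding X_def using eg pos by (intro mult_left_mono sqrt_min_mono divide_right_mono) auto
    then show "incidence_bound e g \<le> incidence_bound ?e ?g"
      unfolding X_def incidence_bound_def using that pos
      by (intro add_mono mult_mono sqrt_min_mono divide_right_mono mult_nonneg_nonneg sqrt_min_nonneg) auto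
    show "e * g / q \<le> ?e * ?g / q" using eg pos by (intro divide_right_mono) auto
  qed
  have card_le: "real (card A) \<le> real (card B)" if "A \<subseteq> B" "finite B" for A B :: "'v set"
    using that by (simp add: card_mono)
  have part1: "incidences ?P (E \<inter> {origin}) (G - {origin}) \<le> 2 * X"
  proof (cases "origin \<in> E")
    case True
    then have e1: "1 \<le> ?e" using fin by (metis One_nat_def Suc_leI card_gt_0_iff empty_iff of_nat_1 of_nat_le_iff)
    have "incidences ?P (E \<inter> {origin}) (G - {origin}) \<le> 1 * real (card (G - {origin}))"
      using incidences_le_card_mult[of ?P "E \<inter> {origin}" "G - {origin}"] True by simp
    also have "\<dots> \<le> ?g" using card_le[of "G - {origin}" G] fin by auto
    also have "\<dots> \<le> 2 * X" unfolding X_def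
    proof (rule mult_sqrt_min_ge)
      show "?g \<le> 2 * ?L" using card_C_le[OF nontrivial] card_le[OF G finite_C] by simp
      show "?g \<le> ?e * ?g" using mult_right_mono[OF e1, of ?g] by simp
    qed (use pos in auto)
    finally show ?thesis .
  next
    case False
    then show ?thesis using pos by (simp add: incidences_def X_def sqrt_min_nonneg)
  qed
  have part2: "incidences ?P E (G \<inter> {origin}) \<le> 2 * X"
  proof (cases "origin \<in> G")
    case True
    then have g1: "1 \<le> ?g" using fin by (metis One_nat_def Suc_leI card_gt_0_iff empty_iff of_nat_1 of_nat_le_iff)
    have "incidences ?P E (G \<inter> {origin}) = (\<Sum>x\<in>E. of_bool (x \<in> C))"
      unfolding incidences_def using True E by (intro sum.cong refl) (auto simp: C_def b_sym[of _ origin])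
    also have "\<dots> = real (card {x\<in>E. x \<in> C})" by (rule card_conv_sum_of_bool[OF fin(1), symmetric])
    also have "\<dots> \<le> 2 * X" unfolding X_def
    proof (rule mult_sqrt_min_ge)
      show "real (card {x\<in>E. x \<in> C}) \<le> 2 * ?L"
        using card_C_le[OF nontrivial] card_le[of "{x\<in>E. x \<in> C}" C] finite_C by fastforce
      have "real (card {x\<in>E. x \<in> C}) \<le> ?e" using fin by (intro card_le) auto
      also have "\<dots> \<le> ?e * ?g" using mult_left_mono[OF g1, of ?e] by simp
      finally show "real (card {x\<in>E. x \<in> C}) \<le> ?e * ?g" .
    qed (use pos in auto)
    finally show ?thesis .
  next
    case False
    then show ?thesis using pos by (simp add: incidences_def X_def sqrt_min_nonneg)
  qed
  have cards: "real (card (G - {origin})) \<le> ?g" "real (card (E - C)) \<le> ?e" "real (card (E \<inter> C - {origin})) \<le> ?e"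
    using fin by (auto intro!: card_mono)
  have part3: "incidences ?P (E - C) (G - {origin}) \<le> ?e * ?g / q + X"
  proof -
    have "E - C \<subseteq> V - C" "G - {origin} \<subseteq> V - {origin}" using E G C_subset by auto
    from anisotropic_incidences_le[OF this] mono(1,3)[OF _ cards(2) _ cards(1)]
    show ?thesis by simp
  qed
  have part4: "incidences ?P (E \<inter> C - {origin}) (G - {origin}) \<le> ?e * ?g / q + 2 * incidence_bound ?e ?g"
  proof -
    have "incidences ?P (E \<inter> C - {origin}) (G - {origin}) = incidences (\<lambda>x y. b x y = \<zero>) (E \<inter> C - {origin}) (G - {origin})"
      unfolding incidences_def by (intro sum.cong refl) (auto simp: C_def)
    also have "\<dots> \<le> real (card (E \<inter> C - {origin})) * real (card (G - {origin})) / q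
        + 2 * incidence_bound (real (card (E \<inter> C - {origin}))) (real (card (G - {origin})))"
      using G by (intro isotropic_incidences_le) auto
    also have "\<dots> \<le> ?e * ?g / q + 2 * incidence_bound ?e ?g"
      using mono(2,3)[OF of_nat_0_le_iff cards(3) of_nat_0_le_iff cards(1)] by linarith
    finally show ?thesis .
  qed
  have "incidences ?P E G = incidences ?P E ((G - {origin}) \<union> (G \<inter> {origin}))"
    by (intro arg_cong[where f = "incidences ?P E"]) auto
  also have "\<dots> = incidences ?P E (G - {origin}) + incidences ?P E (G \<inter> {origin})"
    using fin by (intro incidences_Un_right) auto
  also have "incidences ?P E (G - {origin}) =
      incidences ?P (((E \<inter> {origin}) \<union> (E \<inter> C - {origin})) \<union> (E - C)) (G - {origin})"
    by (intro arg_cong[where f = "\<lambda>E. incidences ?P E (G - {origin})"]) (auto simp: C_def)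
  also have "\<dots> = incidences ?P (E \<inter> {origin}) (G - {origin}) + incidences ?P (E \<inter> C - {origin}) (G - {origin})
      + incidences ?P (E - C) (G - {origin})"
    using fin by (subst incidences_Un_left; (subst incidences_Un_left)?) (auto simp: C_def)
  \<comment> \<open>The coefficients of \<open>X\<close> add up to 5; with
    \<open>X \<le> incidence_bound\<close> and the two explicit copies of
    \<open>incidence_bound\<close> this makes 7.\<close>
  finally have "incidences ?P E G \<le> 2 * X + (?e * ?g / q + 2 * incidence_bound ?e ?g) + (?e * ?g / q + X) + 2 * X"
    using part1 part2 part3 part4 by linarith
  then have "incidences ?P E G \<le> 2 * (?e * ?g / q) + 7 * incidence_bound ?e ?g"
    using B by linarith
  then show ?thesis by (simp add: mult.assoc)
qed

end

section \<open>Dyadic sums\<close>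

lemma sqrt_min_le_powr:
  assumes "0 < t" "1/2 < \<beta>" "\<beta> < 1"
  shows "sqrt_min t \<le> t powr \<beta>"
proof (cases "t \<le> 1")
  case True
  then have "t powr 1 \<le> t powr \<beta>" using assms by (intro powr_mono') auto
  then show ?thesis using True assms by (simp add: sqrt_min_le_1)
next
  case False
  then have "t powr (1/2) \<le> t powr \<beta>" using assms by (intro powr_mono) auto
  then show ?thesis using False by (simp add: sqrt_min_ge_1 powr_half_sqrt)
qed

text \<open>The terms grow geometrically while \<open>\<rho>^j T \<le> 1\<close> and decay
  geometrically afterwards, so the sum is comparable to its largest term. Every term is at most
  \<open>T powr \<beta>\<close>, because the weight \<open>(1/2)^j\<close> cancels the growth of
  \<open>(\<rho>^j) powr \<beta>\<close>.\<close>

lemma dyadic_sqrt_min_sum: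
  assumes "1/2 < \<beta>" "\<beta> < 1"
  shows "\<exists>K>0. \<forall>T>0. \<forall>n. (\<Sum>j<n. (1/2)^j * sqrt_min (2 powr (real j / \<beta>) * T)) \<le> K * T powr \<beta>"
proof -
  \<comment> \<open>\<open>1/2 < \<beta> < 1\<close> places \<open>\<rho>\<close> strictly between 2
    and 4, so that \<open>a > 1\<close> is the ratio of growth and \<open>c < 1\<close> the ratio of
    decay.\<close>
  define \<rho> where "\<rho> = 2 powr (1 / \<beta>)"
  define a where "a = \<rho> / 2"
  define c where "c = sqrt \<rho> / 2"
  have \<rho>: "0 < \<rho>" by (simp add: \<rho>_def)
  have "2 powr 1 < \<rho>" unfolding \<rho>_def using assms by (intro powr_less_mono) auto
  then have a: "1 < a" by (simp add: a_def)
  have "\<rho> < 2 powr 2" unfolding \<rho>_def using assms by (intro powr_less_mono) (auto simp: field_simps)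
  then have "sqrt \<rho> < sqrt (2\<^sup>2)" by (intro real_sqrt_less_mono) simp
  then have c: "0 \<le> c" "c < 1" using \<rho> by (auto simp: c_def)
  have \<rho>_powr: "2 powr (real j / \<beta>) = \<rho> ^ j" for j
    by (simp add: \<rho>_def powr_powr powr_realpow[symmetric])
  define K where "K = a / (a - 1) + 1 / (1 - c)"
  have K: "0 < K" using a c by (auto simp: K_def intro!: add_pos_pos divide_pos_pos)
  have "(\<Sum>j<n. (1/2)^j * sqrt_min (2 powr (real j / \<beta>) * T)) \<le> K * T powr \<beta>"
    if T: "0 < T" for T n
  proof -
    let ?x = "\<lambda>j. \<rho> ^ j * T"
    let ?t = "\<lambda>j::nat. (1/2)^j * sqrt_min (?x j)"
    have x_pos: "0 < ?x j" for j using T \<rho> by simp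
    have term_le: "?t j \<le> T powr \<beta>" for j
    proof -
      have "(\<rho> ^ j) powr \<beta> = (2 powr (real j / \<beta>)) powr \<beta>" by (simp only: \<rho>_powr)
      also have "\<dots> = 2 ^ j" using assms by (simp add: powr_powr powr_realpow)
      finally have "(?x j) powr \<beta> = 2 ^ j * T powr \<beta>" using T \<rho> by (simp add: powr_mult)
      then have "?t j \<le> (1/2)^j * (2 ^ j * T powr \<beta>)"
        using sqrt_min_le_powr[OF x_pos assms, of j] by (intro mult_left_mono) auto
      then show ?thesis by (simp add: power_one_over)
    qed
    have small: "?t j = T * a ^ j" if "?x j \<le> 1" for j
      using that x_pos[of j] by (simp add: sqrt_min_le_1 a_def power_divide)
    have large: "?t j = sqrt T * c ^ j" if "1 < ?x j" for j
      using that by (simp add: sqrt_min_ge_1 c_def power_divide real_sqrt_mult real_sqrt_power)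
    let ?S = "{j\<in>{..<n}. ?x j \<le> 1}" and ?R = "{j\<in>{..<n}. 1 < ?x j}"
    have "(\<Sum>j\<in>?S. ?t j) \<le> a / (a - 1) * T powr \<beta>"
    proof (cases "?S = {}")
      case True
      then have "(\<Sum>j\<in>?S. ?t j) = 0" by (simp only: sum.empty)
      then show ?thesis using a by simp
    next
      case False
      define k where "k = Max ?S"
      have k: "?x k \<le> 1" "?S \<subseteq> {..<Suc k}"
        using Max_in[of ?S] Max_ge[of ?S] False by (auto simp: k_def less_Suc_eq_le)
      have "(\<Sum>j\<in>?S. ?t j) = (\<Sum>j\<in>?S. T * a ^ j)" using small by (intro sum.cong) auto
      also have "\<dots> \<le> (\<Sum>j<Suc k. T * a ^ j)" using k T a by (intro sum_mono2) auto
      also have "\<dots> = T * ((a ^ Suc k - 1) / (a - 1))"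
        using a by (simp only: sum_distrib_left[symmetric] geometric_sum)
      also have "\<dots> \<le> T * (a ^ Suc k / (a - 1))"
        using T a by (intro mult_left_mono divide_right_mono) auto
      also have "\<dots> = a / (a - 1) * (T * a ^ k)" by simp
      also have "\<dots> \<le> a / (a - 1) * T powr \<beta>"
        using term_le[of k] small[OF k(1)] a by (intro mult_left_mono) auto
      finally show ?thesis .
    qed
    moreover have "(\<Sum>j\<in>?R. ?t j) \<le> 1 / (1 - c) * T powr \<beta>"
    proof (cases "?R = {}")
      case True
      then have "(\<Sum>j\<in>?R. ?t j) = 0" by (simp only: sum.empty)
      then show ?thesis using c by simp
    next
      case False
      define k where "k = Min ?R"
      have k: "1 < ?x k" "?R \<subseteq> {k..<n}" "k < n"
        using Min_in[of ?R] Min_le[of ?R] False by (auto simp: k_def)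
      have "(\<Sum>j\<in>?R. ?t j) = (\<Sum>j\<in>?R. sqrt T * c ^ j)" using large by (intro sum.cong) auto
      also have "\<dots> \<le> (\<Sum>j\<in>{k..<n}. sqrt T * c ^ j)" using k T c by (intro sum_mono2) auto
      also have "\<dots> = (\<Sum>j<n-k. sqrt T * c ^ k * c ^ j)"
        using k by (intro sum.reindex_bij_witness[of _ "\<lambda>j. j + k" "\<lambda>j. j - k"]) (auto simp: power_add[symmetric])
      also have "\<dots> = sqrt T * c ^ k * ((1 - c ^ (n - k)) / (1 - c))"
        using c by (simp only: sum_distrib_left[symmetric] sum_gp_strict) auto
      also have "\<dots> \<le> sqrt T * c ^ k * (1 / (1 - c))"
        using T c by (intro mult_left_mono divide_right_mono) auto
      also have "\<dots> \<le> 1 / (1 - c) * T powr \<beta>"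
        using term_le[of k] large[OF k(1)] c by (simp add: divide_right_mono)
      finally show ?thesis .
    qed
    moreover have "(\<Sum>j<n. ?t j) = (\<Sum>j\<in>?S. ?t j) + (\<Sum>j\<in>?R. ?t j)"
    proof -
      have "{..<n} = ?S \<union> ?R" by auto
      then have "(\<Sum>j<n. ?t j) = (\<Sum>j\<in>?S \<union> ?R. ?t j)" by (rule arg_cong)
      also have "\<dots> = (\<Sum>j\<in>?S. ?t j) + (\<Sum>j\<in>?R. ?t j)" by (intro sum.union_disjoint) auto
      finally show ?thesis .
    qed
    ultimately show ?thesis unfolding \<rho>_powr K_def by (simp add: distrib_right)
  qed
  then show ?thesis using K by blast
qed

text \<open>The sum over \<open>j\<close> is at most a constant times \<open>T powr \<beta>\<close>
  with \<open>T\<close> growing like \<open>2 powr (i/\<alpha>)\<close>. Against the weight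
  \<open>(1/2)^i\<close> this leaves powers of \<open>\<theta>/2\<close>, and
  \<open>\<theta> < 2\<close> because \<beta> < \<alpha>; for equal exponents the ratio would be
  1.\<close>

lemma dyadic_sqrt_min_double_sum_aux:
  assumes "1/2 < \<beta>" "\<beta> < \<alpha>" "\<alpha> < 1"
  shows "\<exists>K>0. \<forall>L>0. \<forall>n m. (\<Sum>i<n. \<Sum>j<m. (1/2)^i * (1/2)^j *
      sqrt_min (2 powr ((real i + 1) / \<alpha>) * 2 powr ((real j + 1) / \<beta>) / L)) \<le> K * L powr (- \<beta>)"
proof -
  obtain K where K: "0 < K"
    "\<And>T n. 0 < T \<Longrightarrow> (\<Sum>j<n. (1/2)^j * sqrt_min (2 powr (real j / \<beta>) * T)) \<le> K * T powr \<beta>"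
    using dyadic_sqrt_min_sum[of \<beta>] assms by auto
  define \<theta> where "\<theta> = 2 powr (\<beta> / \<alpha>)"
  have "\<theta> < 2 powr 1" unfolding \<theta>_def using assms by (intro powr_less_mono) auto
  then have \<theta>: "0 < \<theta>" "\<theta> / 2 < 1" "0 < \<theta> / 2" by (auto simp: \<theta>_def)
  define K' where "K' = K * 2 * \<theta> * (1 / (1 - \<theta> / 2))"
  have K': "0 < K'" using K \<theta> by (simp add: K'_def)
  have "(\<Sum>i<n. \<Sum>j<m. (1/2)^i * (1/2)^j *
      sqrt_min (2 powr ((real i + 1) / \<alpha>) * 2 powr ((real j + 1) / \<beta>) / L)) \<le> K' * L powr (- \<beta>)"
    if L: "0 < L" for L n m
  proof -
    have "(\<Sum>j<m. (1/2)^i * (1/2)^j * sqrt_min (2 powr ((real i + 1) / \<alpha>) * 2 powr ((real j + 1) / \<beta>) / L))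
        \<le> K * 2 * \<theta> * L powr (-\<beta>) * (\<theta> / 2) ^ i" for i
    proof -
      define T where "T = 2 powr ((real i + 1) / \<alpha>) * 2 powr (1 / \<beta>) / L"
      have T: "0 < T" using L by (simp add: T_def)
      have arg: "2 powr ((real i + 1) / \<alpha>) * 2 powr ((real j + 1) / \<beta>) / L = 2 powr (real j / \<beta>) * T" for j
        by (simp add: T_def add_divide_distrib powr_add)
      have T\<beta>: "T powr \<beta> = \<theta> * \<theta> ^ i * 2 * L powr (- \<beta>)"
      proof -
        have "(2 powr ((real i + 1) / \<alpha>)) powr \<beta> = 2 powr ((real i + 1) * (\<beta> / \<alpha>))"
          by (simp add: powr_powr)
        also have "\<dots> = \<theta> powr real (Suc i)" by (simp add: \<theta>_def powr_powr mult.commute add.commute)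
        also have "\<dots> = \<theta> * \<theta> ^ i" using \<theta> by (simp add: powr_realpow del: of_nat_Suc)
        finally have "(2 powr ((real i + 1) / \<alpha>)) powr \<beta> = \<theta> * \<theta> ^ i" .
        moreover have "(2 powr (1 / \<beta>)) powr \<beta> = 2" using assms by (simp add: powr_powr)
        ultimately show ?thesis using L by (simp add: T_def powr_mult powr_divide powr_minus_divide)
      qed
      have "(\<Sum>j<m. (1/2)^i * (1/2)^j * sqrt_min (2 powr ((real i + 1) / \<alpha>) * 2 powr ((real j + 1) / \<beta>) / L))
          = (1/2)^i * (\<Sum>j<m. (1/2)^j * sqrt_min (2 powr (real j / \<beta>) * T))"
        unfolding arg by (simp add: sum_distrib_left mult.assoc)
      also have "\<dots> \<le> (1/2)^i * (K * T powr \<beta>)" using K(2)[OF T] by (intro mult_left_mono) auto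
      also have "\<dots> = K * 2 * \<theta> * L powr (-\<beta>) * (\<theta> / 2) ^ i" by (simp add: T\<beta> power_divide)
      finally show ?thesis .
    qed
    then have "(\<Sum>i<n. \<Sum>j<m. (1/2)^i * (1/2)^j *
        sqrt_min (2 powr ((real i + 1) / \<alpha>) * 2 powr ((real j + 1) / \<beta>) / L))
        \<le> (\<Sum>i<n. K * 2 * \<theta> * L powr (-\<beta>) * (\<theta> / 2) ^ i)"
      by (intro sum_mono)
    also have "\<dots> = K * 2 * \<theta> * L powr (-\<beta>) * ((1 - (\<theta>/2) ^ n) / (1 - \<theta> / 2))"
      using \<theta> by (simp only: sum_distrib_left[symmetric] sum_gp_strict) auto
    also have "\<dots> \<le> K * 2 * \<theta> * L powr (-\<beta>) * (1 / (1 - \<theta> / 2))"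
      using \<theta> K by (intro mult_left_mono divide_right_mono) auto
    also have "\<dots> = K' * L powr (-\<beta>)" by (simp add: K'_def)
    finally show ?thesis .
  qed
  then show ?thesis using K' by blast
qed

lemma dyadic_sqrt_min_double_sum:
  assumes "1/2 < \<alpha>" "\<alpha> < 1" "1/2 < \<beta>" "\<beta> < 1" "\<alpha> \<noteq> \<beta>"
  shows "\<exists>K>0. \<forall>L>0. \<forall>n m. (\<Sum>i<n. \<Sum>j<m. (1/2)^i * (1/2)^j *
      sqrt_min (2 powr ((real i + 1) / \<alpha>) * 2 powr ((real j + 1) / \<beta>) / L)) \<le> K * L powr (- min \<alpha> \<beta>)"
proof (cases "\<beta> < \<alpha>")
  case True
  then show ?thesis using dyadic_sqrt_min_double_sum_aux[of \<beta> \<alpha>] assms by (simp add: min_def)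
next
  case False
  then obtain K where K: "0 < K" "\<And>L n m. 0 < L \<Longrightarrow> (\<Sum>i<n. \<Sum>j<m. (1/2)^i * (1/2)^j *
      sqrt_min (2 powr ((real i + 1) / \<beta>) * 2 powr ((real j + 1) / \<alpha>) / L)) \<le> K * L powr (- \<alpha>)"
    using dyadic_sqrt_min_double_sum_aux[of \<alpha> \<beta>] assms by auto
  have "(\<Sum>i<n. \<Sum>j<m. (1/2)^i * (1/2)^j *
      sqrt_min (2 powr ((real i + 1) / \<alpha>) * 2 powr ((real j + 1) / \<beta>) / L)) \<le> K * L powr (- min \<alpha> \<beta>)"
    if "0 < L" for L n m
    using K(2)[OF that, of n m] False assms by (subst sum.swap) (simp add: min_def mult_ac)
  then show ?thesis using K(1) by blast
qed

section \<open>Dyadic layers of a function and Hoelder's inequality\<close>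

lemma dyadic_level:
  fixes t :: real
  assumes "0 < t" "t \<le> 1"
  shows "\<exists>i. (1/2) ^ Suc i < t \<and> t \<le> (1/2) ^ i"
proof -
  obtain n where "(1/2) ^ n < t" using real_arch_pow_inv[of t "1/2"] assms by auto
  then have "(1/2) ^ Suc n < t" using order_le_less_trans[of "(1/2) ^ Suc n" "(1/2) ^ n" t] by simp
  then have ex: "\<exists>n. (1/2) ^ Suc n < t" by blast
  define i where "i = (LEAST i. (1/2) ^ Suc i < t)"
  have "(1/2) ^ Suc i < t" unfolding i_def using ex by (rule LeastI_ex)
  moreover have "t \<le> (1/2) ^ i"
  proof (cases i)
    case 0
    then show ?thesis using assms by simp
  next
    case (Suc k)
    then have "\<not> (1/2) ^ Suc k < t" using not_less_Least[of k "\<lambda>i. (1/2) ^ Suc i < t"] by (simp add: i_def)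
    then show ?thesis using Suc by simp
  qed
  ultimately show ?thesis by blast
qed

text \<open>The layers are \<open>(1/2)^(i+1) < f \<le> (1/2)^i\<close>, whence the shift
  \<open>i + 1\<close> in the Chebyshev bound on \<open>card (A i)\<close>; the normalisation forces
  \<open>f \<le> 1\<close>. The last conclusion is for the main term \<open>\<mu> e g\<close>: for
  \<alpha> < 1, summing the Chebyshev bounds there would give a quantity growing with
  \<open>n\<close>.\<close>

lemma dyadic_decomposition:
  fixes f :: "'x \<Rightarrow> real"
  assumes fin: "finite X" and f: "\<And>x. x \<in> X \<Longrightarrow> 0 \<le> f x" and \<alpha>: "0 < \<alpha>"
    and norm: "(\<Sum>x\<in>X. f x powr (1 / \<alpha>)) \<le> 1"
  obtains n :: nat and A :: "nat \<Rightarrow> 'x set" where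
    "\<And>i. A i \<subseteq> X" "\<And>i. real (card (A i)) \<le> 2 powr ((real i + 1) / \<alpha>)"
    "\<And>x. x \<in> X \<Longrightarrow> f x \<le> (\<Sum>i<n. (1/2)^i * of_bool (x \<in> A i))"
    "(\<Sum>i<n. (1/2)^i * real (card (A i))) \<le> 2 * (\<Sum>x\<in>X. f x)"
proof -
  have f1: "f x \<le> 1" if "x \<in> X" for x
  proof -
    have "f x powr (1 / \<alpha>) \<le> (\<Sum>x\<in>X. f x powr (1 / \<alpha>))"
      using that fin by (intro member_le_sum) auto
    then have "f x powr (1 / \<alpha>) \<le> 1" using norm by simp
    then have "(f x powr (1 / \<alpha>)) powr \<alpha> \<le> 1" using \<alpha> by (intro powr_le1) auto
    then show ?thesis using \<alpha> f[OF that] by (simp add: powr_powr)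
  qed
  have "\<forall>x\<in>{x\<in>X. 0 < f x}. \<exists>i. (1/2) ^ Suc i < f x \<and> f x \<le> (1/2) ^ i"
    using dyadic_level f1 by simp
  then obtain lev where lev: "\<And>x. x \<in> X \<Longrightarrow> 0 < f x \<Longrightarrow> (1/2) ^ Suc (lev x) < f x \<and> f x \<le> (1/2) ^ lev x"
    by (metis (mono_tags, lifting) mem_Collect_eq)
  define A where "A i = {x\<in>X. 0 < f x \<and> lev x = i}" for i
  obtain n where n: "\<And>x. x \<in> X \<Longrightarrow> lev x < n"
  proof
    fix x assume "x \<in> X"
    then show "lev x < Suc (Max (lev ` X))" using fin by (simp add: less_Suc_eq_le)
  qed
  have single: "(\<Sum>i<n. (1/2::real)^i * of_bool (x \<in> A i)) = (if 0 < f x then (1/2) ^ lev x else 0)"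
    if "x \<in> X" for x
  proof -
    have "(\<Sum>i<n. (1/2::real)^i * of_bool (x \<in> A i)) = (\<Sum>i<n. if i = lev x then (if 0 < f x then (1/2) ^ lev x else 0) else 0)"
      using that by (intro sum.cong) (auto simp: A_def)
    then show ?thesis using n[OF that] by simp
  qed
  show ?thesis
  proof (rule that[of A n])
    show "A i \<subseteq> X" for i by (auto simp: A_def)
    show "real (card (A i)) \<le> 2 powr ((real i + 1) / \<alpha>)" for i
    proof -
      have "real (card (A i)) * ((1/2) ^ Suc i) powr (1 / \<alpha>) = (\<Sum>x\<in>A i. ((1/2) ^ Suc i) powr (1 / \<alpha>))"
        by simp
      also have "\<dots> \<le> (\<Sum>x\<in>A i. f x powr (1 / \<alpha>))"
        using lev \<alpha> by (intro sum_mono powr_mono2) (auto simp: A_def order_less_imp_le)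
      also have "\<dots> \<le> (\<Sum>x\<in>X. f x powr (1 / \<alpha>))"
        using fin by (intro sum_mono2) (auto simp: A_def)
      finally have "real (card (A i)) * ((1/2) ^ Suc i) powr (1 / \<alpha>) \<le> 1" using norm by simp
      moreover have "((1/2) ^ Suc i) powr (1 / \<alpha>) = 1 / 2 powr ((real i + 1) / \<alpha>)"
      proof -
        have "- (real i + 1) = - real (Suc i)" by simp
        then have "2 powr (- (real i + 1)) = 1 / 2 powr real (Suc i)" by (simp only: powr_minus_divide)
        also have "\<dots> = (1/2) ^ Suc i" by (simp only: powr_realpow zero_less_numeral power_one_over)
        finally have "((1/2) ^ Suc i :: real) = 2 powr (- (real i + 1))" ..
        then have "((1/2) ^ Suc i) powr (1 / \<alpha>) = 2 powr (- (real i + 1) * (1 / \<alpha>))"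
          by (simp only: powr_powr)
        also have "- (real i + 1) * (1 / \<alpha>) = - ((real i + 1) / \<alpha>)"
          by (simp only: mult_minus_left times_divide_eq_right mult_1_right)
        finally show ?thesis by (simp only: powr_minus_divide)
      qed
      ultimately have "real (card (A i)) * (1 / 2 powr ((real i + 1) / \<alpha>)) \<le> 1" by (simp only:)
      then show ?thesis by (simp add: divide_le_eq)
    qed
    show "f x \<le> (\<Sum>i<n. (1/2)^i * of_bool (x \<in> A i))" if "x \<in> X" for x
      using single[OF that] lev[OF that] by simp
    have "(\<Sum>i<n. (1/2)^i * real (card (A i))) = (\<Sum>i<n. \<Sum>x\<in>X. (1/2)^i * of_bool (x \<in> A i))"
    proof (intro sum.cong refl)
      fix i
      have "{x\<in>X. x \<in> A i} = A i" by (auto simp: A_def)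
      then show "(1/2)^i * real (card (A i)) = (\<Sum>x\<in>X. (1/2)^i * of_bool (x \<in> A i))"
        unfolding sum_distrib_left[symmetric] card_conv_sum_of_bool[OF fin, symmetric] by simp
    qed
    also have "\<dots> = (\<Sum>x\<in>X. \<Sum>i<n. (1/2)^i * of_bool (x \<in> A i))" by (rule sum.swap)
    also have "\<dots> \<le> (\<Sum>x\<in>X. 2 * f x)"
    proof (rule sum_mono)
      fix x assume x: "x \<in> X"
      show "(\<Sum>i<n. (1/2)^i * of_bool (x \<in> A i)) \<le> 2 * f x"
        unfolding single[OF x] using lev[OF x] f[OF x] by auto
    qed
    finally show "(\<Sum>i<n. (1/2)^i * real (card (A i))) \<le> 2 * (\<Sum>x\<in>X. f x)"
      by (simp add: sum_distrib_left)
  qed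
qed

text \<open>Hoelder's inequality up to a factor 2, by truncation at the height \<open>\<tau>\<close>
  where the small and the large values receive the same bound
  \<open>n powr (1 - \<alpha>)\<close>.\<close>

lemma sum_le_card_powr:
  fixes f :: "'x \<Rightarrow> real"
  assumes fin: "finite X" and f: "\<And>x. x \<in> X \<Longrightarrow> 0 \<le> f x" and \<alpha>: "0 < \<alpha>" "\<alpha> < 1"
    and norm: "(\<Sum>x\<in>X. f x powr (1 / \<alpha>)) \<le> 1"
  shows "(\<Sum>x\<in>X. f x) \<le> 2 * real (card X) powr (1 - \<alpha>)"
proof (cases "X = {}")
  case False
  define n where "n = real (card X)"
  have n: "0 < n" using False fin by (simp add: n_def card_gt_0_iff)
  define \<tau> where "\<tau> = n powr (- \<alpha>)"
  have \<tau>: "0 < \<tau>" using n by (simp add: \<tau>_def)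
  have "f x \<le> \<tau> + f x powr (1 / \<alpha>) * \<tau> powr (1 - 1 / \<alpha>)" if "x \<in> X" for x
  proof (cases "f x \<le> \<tau>")
    case True
    then show ?thesis by (simp add: add_increasing2)
  next
    case False
    then have pos: "0 < f x" using \<tau> by simp
    then have "f x = f x powr (1 / \<alpha>) * f x powr (1 - 1 / \<alpha>)" by (simp add: powr_add[symmetric])
    also have "\<dots> \<le> f x powr (1 / \<alpha>) * \<tau> powr (1 - 1 / \<alpha>)"
      using False \<tau> \<alpha> by (intro mult_left_mono powr_mono2') auto
    finally show ?thesis using \<tau> by simp
  qed
  then have "(\<Sum>x\<in>X. f x) \<le> (\<Sum>x\<in>X. \<tau> + f x powr (1 / \<alpha>) * \<tau> powr (1 - 1 / \<alpha>))"
    by (rule sum_mono)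
  also have "\<dots> = n * \<tau> + (\<Sum>x\<in>X. f x powr (1 / \<alpha>)) * \<tau> powr (1 - 1 / \<alpha>)"
    by (simp add: sum.distrib sum_distrib_right n_def)
  also have "\<dots> \<le> n * \<tau> + 1 * \<tau> powr (1 - 1 / \<alpha>)"
    using norm by (intro add_left_mono mult_right_mono) auto
  also have "n * \<tau> = n powr (1 - \<alpha>)"
    using n by (simp add: \<tau>_def powr_diff powr_minus_divide)
  also have "\<tau> powr (1 - 1 / \<alpha>) = n powr (1 - \<alpha>)"
    using \<alpha> by (simp add: \<tau>_def powr_powr algebra_simps)
  finally show ?thesis by (simp add: n_def)
qed simp

section \<open>From incidence bounds to norm inequalities\<close>

text \<open>Bundles the incidence hypothesis with its parameters left free, so that the constants of
  the analytic lemmas are chosen before the field and hence before \<open>X\<close>,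
  \<open>Y\<close>, \<open>L\<close> and \<open>W\<close>.\<close>

definition incidence_controlled ::
    "('x \<Rightarrow> 'y \<Rightarrow> bool) \<Rightarrow> 'x set \<Rightarrow> 'y set \<Rightarrow> real \<Rightarrow> real \<Rightarrow> real \<Rightarrow> real \<Rightarrow> bool" where
  "incidence_controlled P X Y \<mu> c L W \<longleftrightarrow> finite X \<and> finite Y \<and> 0 \<le> \<mu> \<and> 0 \<le> c \<and> 0 < L \<and> 0 < W \<and>
     (\<forall>E G. E \<subseteq> X \<longrightarrow> G \<subseteq> Y \<longrightarrow> incidences P E G \<le> \<mu> * real (card E) * real (card G) +
        c * (L * sqrt_min (real (card E) * real (card G) / L)
          + W\<^sup>2 * sqrt_min (real (card E) / W) * sqrt_min (real (card G) / W)))"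

lemma dyadic_sqrt_min_sum':
  assumes "1/2 < \<beta>" "\<beta> < 1"
  shows "\<exists>K>0. \<forall>W>0. \<forall>n. (\<Sum>j<n. (1/2)^j * sqrt_min (2 powr ((real j + 1) / \<beta>) / W)) \<le> K * W powr (- \<beta>)"
proof -
  obtain K where K: "0 < K"
    "\<And>T n. 0 < T \<Longrightarrow> (\<Sum>j<n. (1/2)^j * sqrt_min (2 powr (real j / \<beta>) * T)) \<le> K * T powr \<beta>"
    using dyadic_sqrt_min_sum[OF assms] by auto
  have "(\<Sum>j<n. (1/2)^j * sqrt_min (2 powr ((real j + 1) / \<beta>) / W)) \<le> 2 * K * W powr (- \<beta>)"
    if W: "0 < W" for W n
  proof -
    have "2 powr ((real j + 1) / \<beta>) / W = 2 powr (real j / \<beta>) * (2 powr (1 / \<beta>) / W)" for j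
      by (simp add: add_divide_distrib powr_add)
    moreover have "(2 powr (1 / \<beta>) / W) powr \<beta> = 2 * W powr (- \<beta>)"
      using W assms by (simp add: powr_divide powr_powr powr_minus_divide)
    ultimately show ?thesis using K(2)[of "2 powr (1 / \<beta>) / W" n] W by (simp add: mult_ac)
  qed
  then show ?thesis using K(1) by (intro exI[of _ "2 * K"]) auto
qed

lemma incidences_eq_sum_of_bool:
  assumes "finite X" "finite Y" "A \<subseteq> X" "B \<subseteq> Y"
  shows "incidences P A B = (\<Sum>x\<in>X. \<Sum>y\<in>Y. of_bool (x \<in> A) * of_bool (y \<in> B) * of_bool (P x y))"
proof -
  have "incidences P A B = (\<Sum>x\<in>A. \<Sum>y\<in>Y. of_bool (y \<in> B) * of_bool (P x y))"
    unfolding incidences_def using assms by (intro sum.cong refl sum.mono_neutral_cong_left) auto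
  also have "\<dots> = (\<Sum>x\<in>X. \<Sum>y\<in>Y. of_bool (x \<in> A) * of_bool (y \<in> B) * of_bool (P x y))"
    using assms by (intro sum.mono_neutral_cong_left) auto
  finally show ?thesis .
qed

text \<open>Insert the incidence bound layer by layer; the three terms then separate. The main term
  resums to the product of the plain sums, with 4 = 2 * 2 from the two decompositions, the
  \<open>L\<close> term is the double dyadic sum, and the \<open>W\<close> term is a product of two
  single ones.\<close>

lemma bilinear_bound:
  assumes \<alpha>: "1/2 < \<alpha>" "\<alpha> < 1" and \<beta>: "1/2 < \<beta>" "\<beta> < 1" and neq: "\<alpha> \<noteq> \<beta>"
  shows "\<exists>K>0. \<forall>P (X :: 'x set) (Y :: 'y set) \<mu> c L W f g.
    incidence_controlled P X Y \<mu> c L W \<longrightarrow> (\<forall>x\<in>X. 0 \<le> f x) \<longrightarrow> (\<forall>y\<in>Y. 0 \<le> g y) \<longrightarrow>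
    (\<Sum>x\<in>X. f x powr (1 / \<alpha>)) \<le> 1 \<longrightarrow> (\<Sum>y\<in>Y. g y powr (1 / \<beta>)) \<le> 1 \<longrightarrow>
    (\<Sum>x\<in>X. \<Sum>y\<in>Y. f x * g y * of_bool (P x y)) \<le>
      4 * \<mu> * (\<Sum>x\<in>X. f x) * (\<Sum>y\<in>Y. g y) + c * K * (L powr (1 - min \<alpha> \<beta>) + W powr (2 - \<alpha> - \<beta>))"
proof -
  obtain K1 where K1: "0 < K1" "\<And>L n m. 0 < L \<Longrightarrow> (\<Sum>i<n. \<Sum>j<m. (1/2)^i * (1/2)^j *
      sqrt_min (2 powr ((real i + 1) / \<alpha>) * 2 powr ((real j + 1) / \<beta>) / L)) \<le> K1 * L powr (- min \<alpha> \<beta>)"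
    using dyadic_sqrt_min_double_sum[OF \<alpha> \<beta> neq] by blast
  obtain K2 where K2: "0 < K2" "\<And>W n. 0 < W \<Longrightarrow>
      (\<Sum>j<n. (1/2)^j * sqrt_min (2 powr ((real j + 1) / \<alpha>) / W)) \<le> K2 * W powr (- \<alpha>)"
    using dyadic_sqrt_min_sum'[OF \<alpha>] by blast
  obtain K3 where K3: "0 < K3" "\<And>W n. 0 < W \<Longrightarrow>
      (\<Sum>j<n. (1/2)^j * sqrt_min (2 powr ((real j + 1) / \<beta>) / W)) \<le> K3 * W powr (- \<beta>)"
    using dyadic_sqrt_min_sum'[OF \<beta>] by blast
  define K where "K = K1 + K2 * K3"
  have K: "0 < K" using K1(1) K2(1) K3(1) by (simp add: K_def add_pos_pos)
  have "(\<Sum>x\<in>X. \<Sum>y\<in>Y. f x * g y * of_bool (P x y)) \<le>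
      4 * \<mu> * (\<Sum>x\<in>X. f x) * (\<Sum>y\<in>Y. g y) + c * K * (L powr (1 - min \<alpha> \<beta>) + W powr (2 - \<alpha> - \<beta>))"
    if ctrl: "incidence_controlled P X Y \<mu> c L W" and f: "\<forall>x\<in>X. 0 \<le> f x" and g: "\<forall>y\<in>Y. 0 \<le> g y"
      and nf: "(\<Sum>x\<in>X. f x powr (1 / \<alpha>)) \<le> 1" and ng: "(\<Sum>y\<in>Y. g y powr (1 / \<beta>)) \<le> 1"
    for P and X :: "'x set" and Y :: "'y set" and \<mu> c L W f g
  proof -
    have fin: "finite X" "finite Y" and pos: "0 \<le> \<mu>" "0 \<le> c" "0 < L" "0 < W"
      and inc: "\<And>E G. E \<subseteq> X \<Longrightarrow> G \<subseteq> Y \<Longrightarrow> incidences P E G \<le> \<mu> * real (card E) * real (card G) +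
        c * (L * sqrt_min (real (card E) * real (card G) / L)
          + W\<^sup>2 * sqrt_min (real (card E) / W) * sqrt_min (real (card G) / W))"
      using ctrl unfolding incidence_controlled_def by auto
    have \<alpha>0: "0 < \<alpha>" and \<beta>0: "0 < \<beta>" using \<alpha> \<beta> by auto
    obtain n A where A: "\<And>i. A i \<subseteq> X" "\<And>i. real (card (A i)) \<le> 2 powr ((real i + 1) / \<alpha>)"
      "\<And>x. x \<in> X \<Longrightarrow> f x \<le> (\<Sum>i<n. (1/2)^i * of_bool (x \<in> A i))"
      "(\<Sum>i<n. (1/2)^i * real (card (A i))) \<le> 2 * (\<Sum>x\<in>X. f x)"
      by (rule dyadic_decomposition[OF fin(1) bspec[OF f] \<alpha>0 nf]) (assumption, blast)
    obtain m B where B: "\<And>j. B j \<subseteq> Y" "\<And>j. real (card (B j)) \<le> 2 powr ((real j + 1) / \<beta>)"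
      "\<And>y. y \<in> Y \<Longrightarrow> g y \<le> (\<Sum>j<m. (1/2)^j * of_bool (y \<in> B j))"
      "(\<Sum>j<m. (1/2)^j * real (card (B j))) \<le> 2 * (\<Sum>y\<in>Y. g y)"
      by (rule dyadic_decomposition[OF fin(2) bspec[OF g] \<beta>0 ng]) (assumption, blast)
    let ?h = "\<lambda>i j. (1/2)^i * (1/2)^j :: real"
    let ?a = "\<lambda>i::nat. 2 powr ((real i + 1) / \<alpha>)" and ?b = "\<lambda>j::nat. 2 powr ((real j + 1) / \<beta>)"
    have "(\<Sum>x\<in>X. \<Sum>y\<in>Y. f x * g y * of_bool (P x y))
        \<le> (\<Sum>x\<in>X. \<Sum>y\<in>Y. (\<Sum>i<n. (1/2)^i * of_bool (x \<in> A i)) * (\<Sum>j<m. (1/2)^j * of_bool (y \<in> B j)) * of_bool (P x y))"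
    proof (intro sum_mono)
      fix x y assume x: "x \<in> X" and y: "y \<in> Y"
      have "f x * g y \<le> (\<Sum>i<n. (1/2)^i * of_bool (x \<in> A i)) * (\<Sum>j<m. (1/2)^j * of_bool (y \<in> B j))"
        using f g x y by (intro mult_mono A(3) B(3) sum_nonneg) auto
      then show "f x * g y * of_bool (P x y) \<le> (\<Sum>i<n. (1/2)^i * of_bool (x \<in> A i)) *
          (\<Sum>j<m. (1/2)^j * of_bool (y \<in> B j)) * of_bool (P x y)"
        by (rule mult_right_mono) simp
    qed
    also have "\<dots> = (\<Sum>x\<in>X. \<Sum>y\<in>Y. \<Sum>i<n. \<Sum>j<m. ?h i j * (of_bool (x \<in> A i) * of_bool (y \<in> B j) * of_bool (P x y)))"
      unfolding sum_product sum_distrib_right by (intro sum.cong refl) (simp only: sum_distrib_left mult_ac)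
    also have "\<dots> = (\<Sum>x\<in>X. \<Sum>i<n. \<Sum>y\<in>Y. \<Sum>j<m. ?h i j * (of_bool (x \<in> A i) * of_bool (y \<in> B j) * of_bool (P x y)))"
      by (intro sum.cong refl sum.swap)
    also have "\<dots> = (\<Sum>i<n. \<Sum>x\<in>X. \<Sum>j<m. \<Sum>y\<in>Y. ?h i j * (of_bool (x \<in> A i) * of_bool (y \<in> B j) * of_bool (P x y)))"
      by (subst sum.swap) (intro sum.cong refl sum.swap)
    also have "\<dots> = (\<Sum>i<n. \<Sum>j<m. \<Sum>x\<in>X. \<Sum>y\<in>Y. ?h i j * (of_bool (x \<in> A i) * of_bool (y \<in> B j) * of_bool (P x y)))"
      by (intro sum.cong refl sum.swap)
    also have "\<dots> = (\<Sum>i<n. \<Sum>j<m. ?h i j * incidences P (A i) (B j))"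
      by (simp only: incidences_eq_sum_of_bool[OF fin A(1) B(1)] sum_distrib_left)
    also have "\<dots> \<le> (\<Sum>i<n. \<Sum>j<m. \<mu> * (((1/2)^i * real (card (A i))) * ((1/2)^j * real (card (B j))))
        + c * (L * (?h i j * sqrt_min (?a i * ?b j / L))
          + W\<^sup>2 * (((1/2)^i * sqrt_min (?a i / W)) * ((1/2)^j * sqrt_min (?b j / W)))))"
    proof (intro sum_mono)
      fix i j
      have "L * sqrt_min (real (card (A i)) * real (card (B j)) / L)
            + W\<^sup>2 * sqrt_min (real (card (A i)) / W) * sqrt_min (real (card (B j)) / W)
          \<le> L * sqrt_min (?a i * ?b j / L) + W\<^sup>2 * sqrt_min (?a i / W) * sqrt_min (?b j / W)"
        using pos A(2)[of i] B(2)[of j]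
        by (intro add_mono mult_mono sqrt_min_mono divide_right_mono sqrt_min_nonneg mult_nonneg_nonneg) auto
      then have "c * (L * sqrt_min (real (card (A i)) * real (card (B j)) / L)
            + W\<^sup>2 * sqrt_min (real (card (A i)) / W) * sqrt_min (real (card (B j)) / W))
          \<le> c * (L * sqrt_min (?a i * ?b j / L) + W\<^sup>2 * sqrt_min (?a i / W) * sqrt_min (?b j / W))"
        using pos by (intro mult_left_mono) auto
      with inc[OF A(1)[of i] B(1)[of j]]
      have "incidences P (A i) (B j) \<le> \<mu> * real (card (A i)) * real (card (B j)) +
          c * (L * sqrt_min (?a i * ?b j / L) + W\<^sup>2 * sqrt_min (?a i / W) * sqrt_min (?b j / W))"
        by linarith
      then have "?h i j * incidences P (A i) (B j) \<le> ?h i j * (\<mu> * real (card (A i)) * real (card (B j)) +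
          c * (L * sqrt_min (?a i * ?b j / L) + W\<^sup>2 * sqrt_min (?a i / W) * sqrt_min (?b j / W)))"
        by (intro mult_left_mono) auto
      also have "\<dots> = \<mu> * (((1/2)^i * real (card (A i))) * ((1/2)^j * real (card (B j))))
        + c * (L * (?h i j * sqrt_min (?a i * ?b j / L))
          + W\<^sup>2 * (((1/2)^i * sqrt_min (?a i / W)) * ((1/2)^j * sqrt_min (?b j / W))))"
        by (simp only: distrib_left distrib_right mult_ac)
      finally show "?h i j * incidences P (A i) (B j) \<le> \<dots>" .
    qed
    also have "\<dots> = \<mu> * ((\<Sum>i<n. (1/2)^i * real (card (A i))) * (\<Sum>j<m. (1/2)^j * real (card (B j))))
        + c * (L * (\<Sum>i<n. \<Sum>j<m. ?h i j * sqrt_min (?a i * ?b j / L))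
          + W\<^sup>2 * ((\<Sum>i<n. (1/2)^i * sqrt_min (?a i / W)) * (\<Sum>j<m. (1/2)^j * sqrt_min (?b j / W))))"
      by (simp only: sum.distrib sum_distrib_left[symmetric] sum_product)
    also have "\<dots> \<le> \<mu> * ((2 * (\<Sum>x\<in>X. f x)) * (2 * (\<Sum>y\<in>Y. g y)))
        + c * (L * (K1 * L powr (- min \<alpha> \<beta>)) + W\<^sup>2 * ((K2 * W powr (- \<alpha>)) * (K3 * W powr (- \<beta>))))"
    proof -
      have "(\<Sum>i<n. (1/2)^i * real (card (A i))) * (\<Sum>j<m. (1/2)^j * real (card (B j)))
          \<le> (2 * (\<Sum>x\<in>X. f x)) * (2 * (\<Sum>y\<in>Y. g y))"
        using f by (intro mult_mono A(4) B(4) sum_nonneg mult_nonneg_nonneg) auto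
      moreover have "L * (\<Sum>i<n. \<Sum>j<m. ?h i j * sqrt_min (?a i * ?b j / L)) \<le> L * (K1 * L powr (- min \<alpha> \<beta>))"
        using pos by (intro mult_left_mono K1(2)) auto
      moreover have "(\<Sum>i<n. (1/2)^i * sqrt_min (?a i / W)) * (\<Sum>j<m. (1/2)^j * sqrt_min (?b j / W))
          \<le> (K2 * W powr (- \<alpha>)) * (K3 * W powr (- \<beta>))"
        using pos K2(1) by (intro mult_mono K2(2) K3(2) sum_nonneg mult_nonneg_nonneg sqrt_min_nonneg) auto
      ultimately show ?thesis
        using pos by (intro add_mono mult_left_mono) auto
    qed
    also have "\<dots> = 4 * \<mu> * (\<Sum>x\<in>X. f x) * (\<Sum>y\<in>Y. g y)
        + c * (K1 * L powr (1 - min \<alpha> \<beta>) + (K2 * K3) * W powr (2 - \<alpha> - \<beta>))"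
    proof -
      have "L powr (1 - min \<alpha> \<beta>) = L * L powr (- min \<alpha> \<beta>)"
        using pos by (simp add: powr_diff powr_minus_divide)
      moreover have "W powr (2 - \<alpha> - \<beta>) = W\<^sup>2 * (W powr (- \<alpha>) * W powr (- \<beta>))"
        using pos by (simp add: powr_diff powr_minus_divide)
      ultimately show ?thesis by (simp add: algebra_simps)
    qed
    also have "\<dots> \<le> 4 * \<mu> * (\<Sum>x\<in>X. f x) * (\<Sum>y\<in>Y. g y)
        + c * (K * L powr (1 - min \<alpha> \<beta>) + K * W powr (2 - \<alpha> - \<beta>))"
      using pos K1(1) K2(1) K3(1) unfolding K_def
      by (intro add_left_mono mult_left_mono add_mono mult_right_mono) auto
    finally show ?thesis by (simp add: algebra_simps)
  qed
  then show ?thesis using K by blast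
qed

text \<open>Duality: \<open>1/\<beta>\<close> and \<open>1/(1 - \<beta>)\<close> are conjugate
  exponents, so testing the bilinear bound against one extremal \<open>g\<close> recovers the norm.
  Hoelder then turns the plain sums of the main term into powers of cardinalities.\<close>

lemma strong_type_bound:
  assumes \<alpha>: "1/2 < \<alpha>" "\<alpha> < 1" and \<beta>: "1/2 < \<beta>" "\<beta> < 1" and neq: "\<alpha> \<noteq> \<beta>"
  shows "\<exists>K>0. \<forall>P (X :: 'x set) (Y :: 'y set) \<mu> c L W f.
    incidence_controlled P X Y \<mu> c L W \<longrightarrow> (\<forall>x\<in>X. 0 \<le> f x) \<longrightarrow>
    (\<Sum>y\<in>Y. (\<Sum>x\<in>X. f x * of_bool (P x y)) powr (1 / (1 - \<beta>))) powr (1 - \<beta>) \<le>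
      K * (\<mu> * real (card X) powr (1 - \<alpha>) * real (card Y) powr (1 - \<beta>)
         + c * (L powr (1 - min \<alpha> \<beta>) + W powr (2 - \<alpha> - \<beta>))) * (\<Sum>x\<in>X. f x powr (1 / \<alpha>)) powr \<alpha>"
proof -
  obtain K where K: "0 < K" "\<And>P (X :: 'x set) (Y :: 'y set) \<mu> c L W f g.
    \<lbrakk>incidence_controlled P X Y \<mu> c L W; \<forall>x\<in>X. 0 \<le> f x; \<forall>y\<in>Y. 0 \<le> g y;
    (\<Sum>x\<in>X. f x powr (1 / \<alpha>)) \<le> 1; (\<Sum>y\<in>Y. g y powr (1 / \<beta>)) \<le> 1\<rbrakk> \<Longrightarrow>
    (\<Sum>x\<in>X. \<Sum>y\<in>Y. f x * g y * of_bool (P x y)) \<le>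
      4 * \<mu> * (\<Sum>x\<in>X. f x) * (\<Sum>y\<in>Y. g y) + c * K * (L powr (1 - min \<alpha> \<beta>) + W powr (2 - \<alpha> - \<beta>))"
    using bilinear_bound[OF assms, where ?'x = 'x and ?'y = 'y] by blast
  have "(\<Sum>y\<in>Y. (\<Sum>x\<in>X. f x * of_bool (P x y)) powr (1 / (1 - \<beta>))) powr (1 - \<beta>) \<le>
      (16 + K) * (\<mu> * real (card X) powr (1 - \<alpha>) * real (card Y) powr (1 - \<beta>)
         + c * (L powr (1 - min \<alpha> \<beta>) + W powr (2 - \<alpha> - \<beta>))) * (\<Sum>x\<in>X. f x powr (1 / \<alpha>)) powr \<alpha>"
    if ctrl: "incidence_controlled P X Y \<mu> c L W" and f: "\<forall>x\<in>X. 0 \<le> f x"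
    for P and X :: "'x set" and Y :: "'y set" and \<mu> c L W f
  proof -
    have fin: "finite X" "finite Y" and pos: "0 \<le> \<mu>" "0 \<le> c"
      using ctrl unfolding incidence_controlled_def by auto
    define u where "u y = (\<Sum>x\<in>X. f x * of_bool (P x y))" for y
    define S where "S = (\<Sum>x\<in>X. f x powr (1 / \<alpha>))"
    define R where "R = (\<Sum>y\<in>Y. u y powr (1 / (1 - \<beta>)))"
    define M where "M = \<mu> * real (card X) powr (1 - \<alpha>) * real (card Y) powr (1 - \<beta>)"
    define Z where "Z = c * (L powr (1 - min \<alpha> \<beta>) + W powr (2 - \<alpha> - \<beta>))"
    have MZ: "0 \<le> M" "0 \<le> Z" using pos by (auto simp: M_def Z_def)
    have u: "0 \<le> u y" for y using f by (auto simp: u_def intro!: sum_nonneg)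
    have S0: "0 \<le> S" and R0: "0 \<le> R" by (auto simp: S_def R_def intro!: sum_nonneg)
    have "R powr (1 - \<beta>) \<le> (16 + K) * (M + Z) * S powr \<alpha>"
    proof (cases "R = 0")
      case True
      then show ?thesis using K(1) MZ by simp
    next
      case False
      then have R: "0 < R" using R0 by simp
      have S: "0 < S"
      proof (rule ccontr)
        assume "\<not> 0 < S"
        then have "S = 0" using S0 by simp
        then have "\<forall>x\<in>X. f x powr (1 / \<alpha>) = 0" unfolding S_def using fin by (subst (asm) sum_nonneg_eq_0_iff) auto
        then have "\<forall>x\<in>X. f x = 0" by simp
        then have "R = 0" by (simp add: R_def u_def)
        then show False using R by simp
      qed
      define f' where "f' x = f x / S powr \<alpha>" for x
      \<comment> \<open>The extremal function for \<open>u\<close> in Hoelder's inequality, scaled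
        to norm 1.\<close>
      define g where "g y = u y powr (\<beta> / (1 - \<beta>)) / R powr \<beta>" for y
      have f': "\<forall>x\<in>X. 0 \<le> f' x" using f by (simp add: f'_def)
      have g: "\<forall>y\<in>Y. 0 \<le> g y" by (simp add: g_def)
      have nf: "(\<Sum>x\<in>X. f' x powr (1 / \<alpha>)) \<le> 1"
      proof -
        have "f' x powr (1 / \<alpha>) = f x powr (1 / \<alpha>) / S" if "x \<in> X" for x
          using that f S \<alpha> by (simp add: f'_def powr_divide powr_powr)
        then have "(\<Sum>x\<in>X. f' x powr (1 / \<alpha>)) = (\<Sum>x\<in>X. f x powr (1 / \<alpha>) / S)"
          by (intro sum.cong) auto
        also have "\<dots> = S / S" by (simp only: sum_divide_distrib[symmetric] S_def)
        finally have "(\<Sum>x\<in>X. f' x powr (1 / \<alpha>)) = S / S" .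
        then show ?thesis using S by simp
      qed
      have ng: "(\<Sum>y\<in>Y. g y powr (1 / \<beta>)) \<le> 1"
      proof -
        have "g y powr (1 / \<beta>) = u y powr (1 / (1 - \<beta>)) / R" for y
          using R \<beta> by (simp add: g_def powr_divide powr_powr)
        then have "(\<Sum>y\<in>Y. g y powr (1 / \<beta>)) = R / R"
          by (simp only: sum_divide_distrib[symmetric] R_def)
        then show ?thesis using R by simp
      qed
      have "(\<Sum>x\<in>X. \<Sum>y\<in>Y. f' x * g y * of_bool (P x y)) = (\<Sum>y\<in>Y. g y * u y / S powr \<alpha>)"
        by (subst sum.swap, intro sum.cong refl)
          (simp add: u_def f'_def sum_distrib_left sum_divide_distrib mult_ac)
      also have "\<dots> = (\<Sum>y\<in>Y. u y powr (1 / (1 - \<beta>)) / (R powr \<beta> * S powr \<alpha>))"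
      proof (intro sum.cong refl)
        fix y
        have "1 / (1 - \<beta>) = \<beta> / (1 - \<beta>) + 1" using \<beta> by (simp add: field_simps)
        then have "u y powr (1 / (1 - \<beta>)) = u y powr (\<beta> / (1 - \<beta>)) * u y"
          using u[of y] by (simp add: powr_add)
        then show "g y * u y / S powr \<alpha> = u y powr (1 / (1 - \<beta>)) / (R powr \<beta> * S powr \<alpha>)"
          by (simp add: g_def)
      qed
      also have "\<dots> = R / (R powr \<beta> * S powr \<alpha>)" by (simp add: R_def sum_divide_distrib)
      also have "\<dots> = R powr (1 - \<beta>) / S powr \<alpha>" using R by (simp add: powr_diff)
      finally have eq: "(\<Sum>x\<in>X. \<Sum>y\<in>Y. f' x * g y * of_bool (P x y)) = R powr (1 - \<beta>) / S powr \<alpha>" .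
      \<comment> \<open>Two uses of \<open>sum_le_card_powr\<close> contribute a factor 2 each,
        whence the 16.\<close>
      have "4 * \<mu> * (\<Sum>x\<in>X. f' x) * (\<Sum>y\<in>Y. g y)
          \<le> 4 * \<mu> * (2 * real (card X) powr (1 - \<alpha>)) * (2 * real (card Y) powr (1 - \<beta>))"
        using pos f' g \<alpha> \<beta> nf ng fin
        by (intro mult_mono mult_left_mono sum_le_card_powr sum_nonneg mult_nonneg_nonneg) auto
      also have "\<dots> = 16 * M" by (simp add: M_def)
      finally have "R powr (1 - \<beta>) / S powr \<alpha> \<le> 16 * M + K * Z"
        using K(2)[OF ctrl f' g nf ng] unfolding eq Z_def by (simp add: mult_ac)
      also have "\<dots> \<le> (16 + K) * (M + Z)" using MZ K(1) by (simp add: algebra_simps)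
      finally show ?thesis using S by (simp add: divide_le_eq)
    qed
    then show ?thesis by (simp only: R_def u_def S_def M_def Z_def)
  qed
  then show ?thesis using K(1) by (intro exI[of _ "16 + K"]) auto
qed

section \<open>The average over the quadric as an incidence sum\<close>

context finite_quadratic_space
begin

lemma translate_invol:
  assumes "x \<in> V" "y \<in> V"
  shows "axpy (\<ominus> \<one>) (axpy (\<ominus> \<one>) x y) y = x"
proof (rule nondegenerate)
  fix z assume z: "z \<in> V"
  have "b y z \<oplus> \<ominus> \<one> \<otimes> (b y z \<oplus> \<ominus> \<one> \<otimes> b x z) = b x z"
    using assms z by (simp add: l_minus minus_add r_neg2)
  then show "b (axpy (\<ominus> \<one>) (axpy (\<ominus> \<one>) x y) y) z = b x z"
    using assms z by (simp add: b_axpy)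
qed (use assms in auto)

lemma sum_translate_C:
  fixes h :: "'v \<Rightarrow> real"
  assumes y: "y \<in> C"
  shows "(\<Sum>x\<in>C. h (axpy (\<ominus> \<one>) x y)) = (\<Sum>z\<in>V. h z * of_bool (Q z = b z y))"
proof -
  have yV: "y \<in> V" "Q y = \<zero>" "b y y = \<zero>" using y b_self by (auto simp: C_def)
  have "(\<Sum>x\<in>C. h (axpy (\<ominus> \<one>) x y)) = (\<Sum>z\<in>{z\<in>V. Q z = b z y}. h z)"
  \<comment> \<open>The substitution \<open>z = y - x\<close> is an involution, so the same formula
    serves in both directions.\<close>
  proof (rule sum.reindex_bij_witness[of _ "\<lambda>z. axpy (\<ominus> \<one>) z y" "\<lambda>x. axpy (\<ominus> \<one>) x y"])
    show "axpy (\<ominus> \<one>) x y \<in> {z\<in>V. Q z = b z y}" if "x \<in> C" for x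
      using that yV by (simp add: C_def Q_axpy b_axpy)
    show "axpy (\<ominus> \<one>) z y \<in> C" if "z \<in> {z\<in>V. Q z = b z y}" for z
      using that yV by (simp add: C_def Q_axpy l_minus r_neg l_neg)
  qed (use yV in \<open>auto simp: C_def translate_invol\<close>)
  also have "\<dots> = (\<Sum>z\<in>V. h z * of_bool (Q z = b z y))"
    using finite_V by (intro sum.mono_neutral_cong_left) auto
  finally show ?thesis .
qed

lemma incidence_controlled_V_C:
  assumes "\<exists>x\<in>C. x \<noteq> origin"
  shows "incidence_controlled (\<lambda>x y. Q x = b x y) V C (2 / q) 7 (N / q) (sqrt N)"
  unfolding incidence_controlled_def
  using incidences_le[OF assms] finite_V finite_C q_ge_2 N_ge_1
  by (auto simp: incidence_bound_def)

end

section \<open>The cone as a quadric\<close>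

text \<open>In a group of order \<open>2k + 1\<close>, Lagrange gives \<open>(2k + 1) x = 0\<close>,
  and \<open>2x = 0\<close> leaves just \<open>x\<close>. This is where odd \<open>q\<close> enters:
  it makes the doubled products in \<open>cone_bilinear\<close> nondegenerate.\<close>

lemma (in abelian_group) double_eq_zero_imp:
  assumes fin: "finite (carrier G)" "odd (card (carrier G))" and x: "x \<in> carrier G" "x \<oplus> x = \<zero>"
  shows "x = \<zero>"
proof -
  obtain k where k: "card (carrier G) = 2 * k + 1" using fin by (elim oddE)
  have one: "x [^]\<^bsub>add_monoid G\<^esub> (2::nat) = \<zero>" using x by (simp add: numeral_2_eq_2)
  have "x [^]\<^bsub>add_monoid G\<^esub> (card (carrier G)) = \<zero>"
    using comm_group.power_order_eq_one[OF a_comm_group, of x] fin x by simp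
  moreover have "x [^]\<^bsub>add_monoid G\<^esub> (2 * k + 1) = x"
  proof -
    have "x [^]\<^bsub>add_monoid G\<^esub> (2 * k + 1) = (x [^]\<^bsub>add_monoid G\<^esub> (2::nat)) [^]\<^bsub>add_monoid G\<^esub> k \<oplus> x"
      using monoid.nat_pow_mult[OF a_monoid, of x "2 * k" 1] monoid.nat_pow_pow[OF a_monoid, of x 2 k] x by simp
    also have "\<dots> = x" unfolding one using monoid.nat_pow_one[OF a_monoid, of k] x by simp
    finally show ?thesis .
  qed
  ultimately show ?thesis using k by simp
qed

definition cone_form :: "'a ring \<Rightarrow> nat \<Rightarrow> (nat \<Rightarrow> 'a) \<Rightarrow> 'a" where
  "cone_form F d x = (\<Oplus>\<^bsub>F\<^esub>i\<in>{1..d - 2}. x i \<otimes>\<^bsub>F\<^esub> x i) \<ominus>\<^bsub>F\<^esub> x (d - 1) \<otimes>\<^bsub>F\<^esub> x d"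

text \<open>The polar form \<open>Q (x + y) - Q x - Q y\<close> of \<open>cone_form\<close>, with
  \<open>2 x_i y_i\<close> written as a repeated sum so that pairing with a unit vector yields a
  doubled coordinate.\<close>

definition cone_bilinear :: "'a ring \<Rightarrow> nat \<Rightarrow> (nat \<Rightarrow> 'a) \<Rightarrow> (nat \<Rightarrow> 'a) \<Rightarrow> 'a" where
  "cone_bilinear F d x y = (\<Oplus>\<^bsub>F\<^esub>i\<in>{1..d - 2}. x i \<otimes>\<^bsub>F\<^esub> y i \<oplus>\<^bsub>F\<^esub> x i \<otimes>\<^bsub>F\<^esub> y i)
     \<ominus>\<^bsub>F\<^esub> (x (d - 1) \<otimes>\<^bsub>F\<^esub> y d \<oplus>\<^bsub>F\<^esub> x d \<otimes>\<^bsub>F\<^esub> y (d - 1))"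

definition coord_axpy :: "'a ring \<Rightarrow> nat \<Rightarrow> 'a \<Rightarrow> (nat \<Rightarrow> 'a) \<Rightarrow> (nat \<Rightarrow> 'a) \<Rightarrow> nat \<Rightarrow> 'a" where
  "coord_axpy F d t x y = (\<lambda>i\<in>{1..d}. y i \<oplus>\<^bsub>F\<^esub> t \<otimes>\<^bsub>F\<^esub> x i)"

definition coord_origin :: "'a ring \<Rightarrow> nat \<Rightarrow> nat \<Rightarrow> 'a" where
  "coord_origin F d = (\<lambda>i\<in>{1..d}. \<zero>\<^bsub>F\<^esub>)"

definition coord_unit :: "'a ring \<Rightarrow> nat \<Rightarrow> nat \<Rightarrow> nat \<Rightarrow> 'a" where
  "coord_unit F d k = (\<lambda>i\<in>{1..d}. if i = k then \<one>\<^bsub>F\<^esub> else \<zero>\<^bsub>F\<^esub>)"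

lemma coord_space_component: "x \<in> coord_space F d \<Longrightarrow> 1 \<le> i \<Longrightarrow> i \<le> d \<Longrightarrow> x i \<in> carrier F"
  by (auto simp: coord_space_def PiE_def Pi_def)

lemma (in abelian_group) finsum_only:
  assumes "finite A" "k \<in> A" "a \<in> carrier G"
  shows "(\<Oplus>i\<in>A. if i = k then a else \<zero>) = a"
  using add.finprod_singleton_swap[of k A "\<lambda>_. a"] assms by simp

lemma cone_quadratic_space:
  fixes R :: "'a ring" (structure)
  assumes "field R" and fin: "finite (carrier R)" and odd: "odd (card (carrier R))" and d: "3 \<le> d"
  shows "finite_quadratic_space R (coord_space R d) (coord_origin R d) (coord_axpy R d)
    (cone_form R d) (cone_bilinear R d)"
proof -
  interpret field R by fact
  show ?thesis
  proof
  let ?V = "coord_space R d" and ?I = "{1..d - 2}"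
  have comp: "x i \<in> carrier R" if "x \<in> ?V" "i \<in> ?I \<or> i = d - 1 \<or> i = d" for x i
    using that d by (intro coord_space_component[of x R d i]) auto
  have idx: "i \<in> {1..d}" if "i \<in> ?I \<or> i = d - 1 \<or> i = d" for i using that d by auto
  show "finite (carrier R)" by fact
  show "finite ?V" unfolding coord_space_def using fin by (intro finite_PiE) auto
  show o: "coord_origin R d \<in> ?V" by (auto simp: coord_origin_def coord_space_def)
  show axpy_in: "coord_axpy R d t x y \<in> ?V" if "t \<in> carrier R" "x \<in> ?V" "y \<in> ?V" for t x y
    using that by (auto simp: coord_axpy_def coord_space_def PiE_def Pi_def)
  show "cone_form R d x \<in> carrier R" if "x \<in> ?V" for x
    using comp[OF that] by (auto simp: cone_form_def intro!: finsum_closed)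
  show "cone_bilinear R d x y \<in> carrier R" if "x \<in> ?V" "y \<in> ?V" for x y
    using comp[OF that(1)] comp[OF that(2)] by (auto simp: cone_bilinear_def intro!: finsum_closed)
  show sym: "cone_bilinear R d x y = cone_bilinear R d y x" if "x \<in> ?V" "y \<in> ?V" for x y
  proof -
    note c = comp[OF that(1)] comp[OF that(2)]
    have "(\<Oplus>i\<in>?I. x i \<otimes> y i \<oplus> x i \<otimes> y i) = (\<Oplus>i\<in>?I. y i \<otimes> x i \<oplus> y i \<otimes> x i)"
      using c by (intro finsum_cong') (auto simp: m_comm)
    moreover have "x (d - 1) \<otimes> y d \<oplus> x d \<otimes> y (d - 1) = y (d - 1) \<otimes> x d \<oplus> y d \<otimes> x (d - 1)"
      using c by (simp add: m_comm a_comm)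
    ultimately show ?thesis by (simp add: cone_bilinear_def)
  qed
  have oi: "coord_origin R d i = \<zero>" if "i \<in> ?I \<or> i = d - 1 \<or> i = d" for i
    using idx[OF that] by (simp add: coord_origin_def)
  show "cone_bilinear R d (coord_origin R d) x = \<zero>" if "x \<in> ?V" for x
  proof -
    note c = comp[OF that]
    have "(\<Oplus>i\<in>?I. coord_origin R d i \<otimes> x i \<oplus> coord_origin R d i \<otimes> x i) = (\<Oplus>i\<in>?I. \<zero>)"
      using c by (intro finsum_cong') (auto simp: oi)
    then show ?thesis using c by (simp add: cone_bilinear_def oi minus_eq)
  qed
  show "cone_form R d (coord_origin R d) = \<zero>"
  proof -
    have "(\<Oplus>i\<in>?I. coord_origin R d i \<otimes> coord_origin R d i) = (\<Oplus>i\<in>?I. \<zero>)"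
      by (intro finsum_cong') (auto simp: oi)
    then show ?thesis by (simp add: cone_form_def oi minus_eq)
  qed
  have ax: "coord_axpy R d t x y i = y i \<oplus> t \<otimes> x i" if "i \<in> ?I \<or> i = d - 1 \<or> i = d" for t x y i
    using idx[OF that] by (simp add: coord_axpy_def)
  show "cone_bilinear R d (coord_axpy R d t x y) z = cone_bilinear R d y z \<oplus> t \<otimes> cone_bilinear R d x z"
    if t: "t \<in> carrier R" and v: "x \<in> ?V" "y \<in> ?V" "z \<in> ?V" for t x y z
  proof -
    note c = comp[OF v(1)] comp[OF v(2)] comp[OF v(3)]
    let ?S = "\<lambda>x. \<Oplus>i\<in>?I. x i \<otimes> z i \<oplus> x i \<otimes> z i"
    have "?S (coord_axpy R d t x y) = (\<Oplus>i\<in>?I. (y i \<otimes> z i \<oplus> y i \<otimes> z i) \<oplus> t \<otimes> (x i \<otimes> z i \<oplus> x i \<otimes> z i))"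
    proof (rule finsum_cong')
      fix i assume i: "i \<in> ?I"
      then have "x i \<in> carrier R" "y i \<in> carrier R" "z i \<in> carrier R" using c by auto
      then show "coord_axpy R d t x y i \<otimes> z i \<oplus> coord_axpy R d t x y i \<otimes> z i
          = (y i \<otimes> z i \<oplus> y i \<otimes> z i) \<oplus> t \<otimes> (x i \<otimes> z i \<oplus> x i \<otimes> z i)"
        using i t by (simp add: ax) algebra
    qed (use c t in auto)
    also have "\<dots> = ?S y \<oplus> (\<Oplus>i\<in>?I. t \<otimes> (x i \<otimes> z i \<oplus> x i \<otimes> z i))"
      using c t by (intro finsum_addf) auto
    also have "(\<Oplus>i\<in>?I. t \<otimes> (x i \<otimes> z i \<oplus> x i \<otimes> z i)) = t \<otimes> ?S x"
      using c t by (intro finsum_rdistr[symmetric]) auto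
    finally have S: "?S (coord_axpy R d t x y) = ?S y \<oplus> t \<otimes> ?S x" .
    have ax': "coord_axpy R d t x y (d-1) = y (d-1) \<oplus> t \<otimes> x (d-1)" "coord_axpy R d t x y d = y d \<oplus> t \<otimes> x d"
      by (simp_all add: ax)
    \<comment> \<open>Stated for arbitrary elements of the carrier, so that \<open>algebra\<close>
      meets the finite sums only as atoms \<open>A\<close> and \<open>B\<close>.\<close>
    have rearrange: "(B \<oplus> t \<otimes> A) \<ominus> ((y1 \<oplus> t \<otimes> x1) \<otimes> z2 \<oplus> (y2 \<oplus> t \<otimes> x2) \<otimes> z1)
        = (B \<ominus> (y1 \<otimes> z2 \<oplus> y2 \<otimes> z1)) \<oplus> t \<otimes> (A \<ominus> (x1 \<otimes> z2 \<oplus> x2 \<otimes> z1))"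
      if "A \<in> carrier R" "B \<in> carrier R" "x1 \<in> carrier R" "x2 \<in> carrier R" "y1 \<in> carrier R" "y2 \<in> carrier R"
        "z1 \<in> carrier R" "z2 \<in> carrier R" for A B x1 x2 y1 y2 z1 z2
      using that t by algebra
    show ?thesis
      unfolding cone_bilinear_def S ax' by (rule rearrange) (use c in \<open>auto intro!: finsum_closed\<close>)
  qed
  show "cone_form R d (coord_axpy R d t x y) =
      cone_form R d y \<oplus> t \<otimes> cone_bilinear R d x y \<oplus> t \<otimes> t \<otimes> cone_form R d x"
    if t: "t \<in> carrier R" and v: "x \<in> ?V" "y \<in> ?V" for t x y
  proof -
    note c = comp[OF v(1)] comp[OF v(2)]
    let ?S = "\<lambda>x. \<Oplus>i\<in>?I. x i \<otimes> x i" and ?T = "\<Oplus>i\<in>?I. x i \<otimes> y i \<oplus> x i \<otimes> y i"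
    have "?S (coord_axpy R d t x y) = (\<Oplus>i\<in>?I. (y i \<otimes> y i \<oplus> t \<otimes> (x i \<otimes> y i \<oplus> x i \<otimes> y i)) \<oplus> t \<otimes> t \<otimes> (x i \<otimes> x i))"
    proof (rule finsum_cong')
      fix i assume i: "i \<in> ?I"
      then have "x i \<in> carrier R" "y i \<in> carrier R" using c by auto
      then show "coord_axpy R d t x y i \<otimes> coord_axpy R d t x y i
          = (y i \<otimes> y i \<oplus> t \<otimes> (x i \<otimes> y i \<oplus> x i \<otimes> y i)) \<oplus> t \<otimes> t \<otimes> (x i \<otimes> x i)"
        using i t by (simp add: ax) algebra
    qed (use c t in auto)
    also have "\<dots> = (\<Oplus>i\<in>?I. y i \<otimes> y i \<oplus> t \<otimes> (x i \<otimes> y i \<oplus> x i \<otimes> y i)) \<oplus> (\<Oplus>i\<in>?I. t \<otimes> t \<otimes> (x i \<otimes> x i))"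
      using c t by (intro finsum_addf) auto
    also have "(\<Oplus>i\<in>?I. y i \<otimes> y i \<oplus> t \<otimes> (x i \<otimes> y i \<oplus> x i \<otimes> y i))
        = ?S y \<oplus> (\<Oplus>i\<in>?I. t \<otimes> (x i \<otimes> y i \<oplus> x i \<otimes> y i))"
      using c t by (intro finsum_addf) auto
    also have "(\<Oplus>i\<in>?I. t \<otimes> (x i \<otimes> y i \<oplus> x i \<otimes> y i)) = t \<otimes> ?T"
      using c t by (intro finsum_rdistr[symmetric]) auto
    also have "(\<Oplus>i\<in>?I. t \<otimes> t \<otimes> (x i \<otimes> x i)) = t \<otimes> t \<otimes> ?S x"
      using c t by (intro finsum_rdistr[symmetric]) auto
    finally have S: "?S (coord_axpy R d t x y) = ?S y \<oplus> t \<otimes> ?T \<oplus> t \<otimes> t \<otimes> ?S x" .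
    have ax': "coord_axpy R d t x y (d-1) = y (d-1) \<oplus> t \<otimes> x (d-1)" "coord_axpy R d t x y d = y d \<oplus> t \<otimes> x d"
      by (simp_all add: ax)
    have rearrange: "(B \<oplus> t \<otimes> T \<oplus> t \<otimes> t \<otimes> A) \<ominus> (y1 \<oplus> t \<otimes> x1) \<otimes> (y2 \<oplus> t \<otimes> x2)
        = (B \<ominus> y1 \<otimes> y2) \<oplus> t \<otimes> (T \<ominus> (x1 \<otimes> y2 \<oplus> x2 \<otimes> y1)) \<oplus> t \<otimes> t \<otimes> (A \<ominus> x1 \<otimes> x2)"
      if "A \<in> carrier R" "B \<in> carrier R" "T \<in> carrier R" "x1 \<in> carrier R" "x2 \<in> carrier R"
        "y1 \<in> carrier R" "y2 \<in> carrier R" for A B T x1 x2 y1 y2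
      using that t by algebra
    show ?thesis
      unfolding cone_form_def cone_bilinear_def S ax' by (rule rearrange) (use c in \<open>auto intro!: finsum_closed\<close>)
  qed
  show "cone_bilinear R d x x = cone_form R d x \<oplus> cone_form R d x" if v: "x \<in> ?V" for x
  proof -
    note c = comp[OF v]
    have "(\<Oplus>i\<in>?I. x i \<otimes> x i \<oplus> x i \<otimes> x i) = (\<Oplus>i\<in>?I. x i \<otimes> x i) \<oplus> (\<Oplus>i\<in>?I. x i \<otimes> x i)"
      using c by (intro finsum_addf) auto
    moreover have "(A \<oplus> A) \<ominus> (x1 \<otimes> x2 \<oplus> x2 \<otimes> x1) = (A \<ominus> x1 \<otimes> x2) \<oplus> (A \<ominus> x1 \<otimes> x2)"
      if "A \<in> carrier R" "x1 \<in> carrier R" "x2 \<in> carrier R" for A x1 x2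
      using that by algebra
    moreover have "(\<Oplus>i\<in>?I. x i \<otimes> x i) \<in> carrier R" "x (d-1) \<in> carrier R" "x d \<in> carrier R"
      using c by (auto intro!: finsum_closed)
    ultimately show ?thesis
      unfolding cone_form_def cone_bilinear_def by (simp only:)
  qed
  show "x = y" if v: "x \<in> ?V" "y \<in> ?V"
    and eq: "\<And>z. z \<in> ?V \<Longrightarrow> cone_bilinear R d x z = cone_bilinear R d y z" for x y
  proof -
    have unit_in: "coord_unit R d k \<in> ?V" for k by (auto simp: coord_unit_def coord_space_def)
    \<comment> \<open>Pairing with unit vectors reads off the coordinates: doubled for the first
      \<open>d - 2\<close>, negated and exchanged for the last two, which span a hyperbolic
      plane.\<close>
    have low: "cone_bilinear R d w (coord_unit R d k) = w k \<oplus> w k" if w: "w \<in> ?V" and k: "k \<in> ?I" for w k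
    proof -
      have "(\<Oplus>i\<in>?I. w i \<otimes> coord_unit R d k i \<oplus> w i \<otimes> coord_unit R d k i)
          = (\<Oplus>i\<in>?I. if i = k then w k \<oplus> w k else \<zero>)"
      proof (rule finsum_cong')
        fix i assume i: "i \<in> ?I"
        then have "coord_unit R d k i = (if i = k then \<one> else \<zero>)" by (auto simp: coord_unit_def)
        moreover have "w i \<in> carrier R" by (rule comp[OF w disjI1[OF i]])
        ultimately show "w i \<otimes> coord_unit R d k i \<oplus> w i \<otimes> coord_unit R d k i = (if i = k then w k \<oplus> w k else \<zero>)"
          by (cases "i = k") simp_all
      qed (use comp[OF w] k in auto)
      also have "\<dots> = w k \<oplus> w k" using comp[OF w] k by (intro finsum_only) auto
      finally have S: "(\<Oplus>i\<in>?I. w i \<otimes> coord_unit R d k i \<oplus> w i \<otimes> coord_unit R d k i) = w k \<oplus> w k" .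
      have "coord_unit R d k (d - 1) = \<zero>" "coord_unit R d k d = \<zero>" using k d by (auto simp: coord_unit_def)
      moreover have "w k \<in> carrier R" "w (d - 1) \<in> carrier R" "w d \<in> carrier R"
        using comp[OF w disjI1[OF k]] comp[OF w, of "d - 1"] comp[OF w, of d] by simp_all
      ultimately show ?thesis unfolding cone_bilinear_def S by (simp add: minus_eq)
    qed
    \<comment> \<open>For \<open>k\<close> equal to \<open>d - 1\<close> or \<open>d\<close>, the
      index \<open>d - 1 + d - k\<close> is the other of the two.\<close>
    have high: "cone_bilinear R d w (coord_unit R d k) = \<ominus> w (d - 1 + d - k)"
      if w: "w \<in> ?V" and k: "k = d - 1 \<or> k = d" for w k
    proof -
      have "(\<Oplus>i\<in>?I. w i \<otimes> coord_unit R d k i \<oplus> w i \<otimes> coord_unit R d k i) = (\<Oplus>i\<in>?I. \<zero>)"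
      proof (rule finsum_cong')
        fix i assume i: "i \<in> ?I"
        then have "i \<noteq> k" "i \<in> {1..d}" using k d by auto
        then have "coord_unit R d k i = \<zero>" by (simp add: coord_unit_def)
        moreover have "w i \<in> carrier R" by (rule comp[OF w disjI1[OF i]])
        ultimately show "w i \<otimes> coord_unit R d k i \<oplus> w i \<otimes> coord_unit R d k i = \<zero>" by simp
      qed auto
      then have S: "(\<Oplus>i\<in>?I. w i \<otimes> coord_unit R d k i \<oplus> w i \<otimes> coord_unit R d k i) = \<zero>" by simp
      have "w (d - 1) \<in> carrier R" "w d \<in> carrier R"
        using comp[OF w, of "d - 1"] comp[OF w, of d] by simp_all
      moreover have "coord_unit R d k (d - 1) = (if k = d then \<zero> else \<one>)" "coord_unit R d k d = (if k = d then \<one> else \<zero>)"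
        using k d by (auto simp: coord_unit_def)
      moreover have "d - 1 + d - (d - 1) = d" "d - 1 + d - d = d - 1" "d - 1 \<noteq> d" using d by auto
      ultimately show ?thesis using k unfolding cone_bilinear_def S by (elim disjE) (simp_all add: minus_eq)
    qed
    have "x i = y i" if "i \<in> {1..d}" for i
    proof (cases "i \<in> ?I")
      case True
      have "x i \<oplus> x i = y i \<oplus> y i"
        using eq[OF unit_in, of i] unfolding low[OF v(1) True] low[OF v(2) True] .
      moreover note comp[OF v(1) disjI1[OF True]] comp[OF v(2) disjI1[OF True]]
      ultimately have e: "x i \<oplus> x i = y i \<oplus> y i" "x i \<in> carrier R" "y i \<in> carrier R" .
      have "(x i \<ominus> y i) \<oplus> (x i \<ominus> y i) = (x i \<oplus> x i) \<ominus> (y i \<oplus> y i)"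
        using e(2,3) by (simp add: minus_eq a_ac minus_add)
      also have "\<dots> = \<zero>" unfolding e(1) using e(3) by (simp only: r_right_minus_eq a_closed)
      finally have "x i \<ominus> y i = \<zero>" by (rule double_eq_zero_imp[OF fin odd minus_closed[OF e(2,3)]])
      then show ?thesis using e(2,3) by (simp only: r_right_minus_eq)
    next
      case False
      then have i: "i = d - 1 \<or> i = d" using that by auto
      define k where "k = d - 1 + d - i"
      have k: "k = d - 1 \<or> k = d" "d - 1 + d - k = i" using i d by (auto simp: k_def)
      have "\<ominus> x i = \<ominus> y i"
        using eq[OF unit_in, of k] unfolding high[OF v(1) k(1)] high[OF v(2) k(1)] k(2) .
      moreover note comp[OF v(1) disjI2[OF i]] comp[OF v(2) disjI2[OF i]]
      ultimately show ?thesis by (metis minus_minus)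
    qed
    then show ?thesis using v unfolding coord_space_def by (intro PiE_ext) auto
  qed
qed
qed

section \<open>The cone average: normalisations, exponents and norms\<close>

lemma cone_eq:
  fixes R :: "'a ring" (structure)
  assumes "field R" and d: "3 \<le> d"
  shows "cone R d = {x\<in>coord_space R d. cone_form R d x = \<zero>}"
proof -
  interpret field R by fact
  have "(\<Oplus>i\<in>{1..d - 2}. x i [^] (2::nat)) = x (d - 1) \<otimes> x d \<longleftrightarrow> cone_form R d x = \<zero>"
    if "x \<in> coord_space R d" for x
  proof -
    have c: "x i \<in> carrier R" if "i \<in> {1..d - 2} \<or> i = d - 1 \<or> i = d" for i
      using that \<open>x \<in> _\<close> d by (intro coord_space_component[of x R d i]) auto
    have "(\<Oplus>i\<in>{1..d - 2}. x i [^] (2::nat)) = (\<Oplus>i\<in>{1..d - 2}. x i \<otimes> x i)"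
      using c by (intro finsum_cong') (auto simp: numeral_2_eq_2)
    moreover have "(\<Oplus>i\<in>{1..d - 2}. x i \<otimes> x i) \<in> carrier R" using c by (auto intro!: finsum_closed)
    moreover have "x (d - 1) \<otimes> x d \<in> carrier R" using c by auto
    ultimately show ?thesis unfolding cone_form_def by (simp only: r_right_minus_eq)
  qed
  then show ?thesis by (auto simp: cone_def)
qed

lemma vec_minus_eq:
  fixes R :: "'a ring" (structure)
  assumes "field R" and "x \<in> coord_space R d" "y \<in> coord_space R d"
  shows "vec_minus R d y x = coord_axpy R d (\<ominus> \<one>) x y"
proof -
  interpret field R by fact
  show ?thesis
    unfolding vec_minus_def coord_axpy_def
    using coord_space_component[OF assms(2)] coord_space_component[OF assms(3)]
    by (intro restrict_ext) (simp add: minus_eq l_minus)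
qed

text \<open>The last unit vector works: its sum of squares and the product of its last two
  coordinates both vanish.\<close>

lemma exists_nonzero_cone:
  fixes R :: "'a ring" (structure)
  assumes "field R" and d: "3 \<le> d"
  shows "\<exists>x\<in>cone R d. x \<noteq> coord_origin R d"
proof -
  interpret field R by fact
  have c: "coord_unit R d d \<in> coord_space R d" by (auto simp: coord_unit_def coord_space_def)
  have "(\<Oplus>i\<in>{1..d - 2}. coord_unit R d d i \<otimes> coord_unit R d d i) = (\<Oplus>i\<in>{1..d - 2}. \<zero>)"
    using d by (intro finsum_cong') (auto simp: coord_unit_def)
  then have "coord_unit R d d \<in> cone R d"
    unfolding cone_eq[OF assms] using c d by (auto simp: cone_form_def coord_unit_def minus_eq)
  moreover have "coord_unit R d d d \<noteq> coord_origin R d d" using d by (simp add: coord_unit_def coord_origin_def)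
  then have "coord_unit R d d \<noteq> coord_origin R d" by metis
  ultimately show ?thesis by blast
qed

text \<open>\<open>D\<close> is the dimension and \<open>n\<close> the size of the cone. The main
  term scales like \<open>q powr \<kappa>\<close> whatever the exponents; the balance equations say
  that the \<open>L\<close> and \<open>W\<close> terms do as well. The power
  \<open>2 - \<beta>\<close> of \<open>1/n\<close> collects the normalisations on the cone, 1 from
  the average and \<open>1 - \<beta>\<close> from the norm, and the right-hand side is the
  normalisation of \<open>dx\<close>.\<close>

lemma exponent_bookkeeping:
  fixes q n D \<alpha> \<beta> :: real
  assumes q: "1 < q" and n: "q powr (D - 1) / 2 \<le> n" "n \<le> 2 * q powr (D - 1)" and \<beta>: "0 < \<beta>" "\<beta> < 1"
    and balance1: "(D - 1) * (1 - min \<alpha> \<beta>) = (D - 1) * (2 - \<beta>) - D * \<alpha>"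
    and balance2: "D / 2 * (2 - \<alpha> - \<beta>) = (D - 1) * (2 - \<beta>) - D * \<alpha>"
  shows "n powr (- (2 - \<beta>)) * (2 / q * (q powr D) powr (1 - \<alpha>) * n powr (1 - \<beta>)
      + 7 * ((q powr D / q) powr (1 - min \<alpha> \<beta>) + sqrt (q powr D) powr (2 - \<alpha> - \<beta>)))
    \<le> 72 * q powr (- (D * \<alpha>))"
proof -
  define \<kappa> where "\<kappa> = (D - 1) * (2 - \<beta>) - D * \<alpha>"
  have pos: "0 < q powr (D - 1)" using q by simp
  have quotient: "(q powr (D - 1) / 2) powr (- e) = 2 powr e * q powr (- ((D - 1) * e))" for e
    using q by (simp add: powr_divide powr_powr powr_minus_divide)
  have "n powr (- (2 - \<beta>)) \<le> (q powr (D - 1) / 2) powr (- (2 - \<beta>))"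
    using n pos \<beta> by (intro powr_mono2') auto
  also have "\<dots> = 2 powr (2 - \<beta>) * q powr (- ((D - 1) * (2 - \<beta>)))"
    by (rule quotient)
  also have "\<dots> \<le> 2 powr 2 * q powr (- ((D - 1) * (2 - \<beta>)))"
    using \<beta> by (intro mult_right_mono powr_mono) auto
  finally have n1: "n powr (- (2 - \<beta>)) \<le> 4 * q powr (- ((D - 1) * (2 - \<beta>)))" by simp
  have "n powr (1 - \<beta>) \<le> (2 * q powr (D - 1)) powr (1 - \<beta>)"
    using n pos \<beta> by (intro powr_mono2) auto
  also have "\<dots> = 2 powr (1 - \<beta>) * q powr ((D - 1) * (1 - \<beta>))"
    using q by (simp add: powr_mult powr_powr)
  also have "\<dots> \<le> 2 powr 1 * q powr ((D - 1) * (1 - \<beta>))"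
    using \<beta> by (intro mult_right_mono powr_mono) auto
  finally have n2: "n powr (1 - \<beta>) \<le> 2 * q powr ((D - 1) * (1 - \<beta>))" by simp
  have "2 / q * (q powr D) powr (1 - \<alpha>) * n powr (1 - \<beta>)
      \<le> 2 / q * (q powr D) powr (1 - \<alpha>) * (2 * q powr ((D - 1) * (1 - \<beta>)))"
    using q n2 by (intro mult_left_mono) auto
  also have "\<dots> = 4 * (q powr (-1) * q powr (D * (1 - \<alpha>)) * q powr ((D - 1) * (1 - \<beta>)))"
    using q by (simp add: powr_powr powr_minus_divide)
  also have "\<dots> = 4 * q powr \<kappa>"
  proof -
    have "- 1 + D * (1 - \<alpha>) + (D - 1) * (1 - \<beta>) = \<kappa>" by (simp add: \<kappa>_def algebra_simps)
    then show ?thesis by (simp only: powr_add[symmetric])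
  qed
  finally have t1: "2 / q * (q powr D) powr (1 - \<alpha>) * n powr (1 - \<beta>) \<le> 4 * q powr \<kappa>" .
  have "q powr D / q = q powr (D - 1)" using q by (simp add: powr_diff)
  then have t2: "(q powr D / q) powr (1 - min \<alpha> \<beta>) = q powr \<kappa>"
    using balance1 by (simp add: powr_powr \<kappa>_def)
  have "sqrt (q powr D) = q powr (D / 2)" by (simp add: powr_half_sqrt[symmetric] powr_powr)
  then have t3: "sqrt (q powr D) powr (2 - \<alpha> - \<beta>) = q powr \<kappa>"
    using balance2 by (simp only: powr_powr \<kappa>_def)
  \<comment> \<open>The three terms give 4 + 7 + 7 = 18, and the power of \<open>n\<close> another
    factor 4, hence 72.\<close>
  have "n powr (- (2 - \<beta>)) * (2 / q * (q powr D) powr (1 - \<alpha>) * n powr (1 - \<beta>)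
      + 7 * ((q powr D / q) powr (1 - min \<alpha> \<beta>) + sqrt (q powr D) powr (2 - \<alpha> - \<beta>)))
    \<le> (4 * q powr (- ((D - 1) * (2 - \<beta>)))) * (18 * q powr \<kappa>)"
    using n1 t1 q unfolding t2 t3 by (intro mult_mono) auto
  also have "\<dots> = 72 * (q powr (- ((D - 1) * (2 - \<beta>))) * q powr \<kappa>)" by simp
  also have "\<dots> = 72 * q powr (- (D * \<alpha>))"
    unfolding \<kappa>_def by (simp add: powr_add[symmetric])
  finally show ?thesis .
qed

text \<open>Here \<alpha> is \<open>1/p\<close> and \<beta> is \<open>1 - 1/r\<close>. The constant
  \<open>K\<close> is obtained before \<open>F\<close> is fixed, and this order is what makes the
  bound uniform in \<open>q\<close>.\<close>

lemma cone_average_bound: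
  fixes d :: nat
  assumes d: "3 \<le> d" and \<alpha>: "1/2 < \<alpha>" "\<alpha> < 1" and \<beta>: "1/2 < \<beta>" "\<beta> < 1" and neq: "\<alpha> \<noteq> \<beta>"
    and balance1: "(real d - 1) * (1 - min \<alpha> \<beta>) = (real d - 1) * (2 - \<beta>) - real d * \<alpha>"
    and balance2: "real d / 2 * (2 - \<alpha> - \<beta>) = (real d - 1) * (2 - \<beta>) - real d * \<alpha>"
  shows "\<exists>c>0. \<forall>(F :: 'a ring) f. finite_field_odd F \<longrightarrow>
    Lr_norm_cone F d (1 / (1 - \<beta>)) (cone_average F d f) \<le> c * Lp_norm_dx F d (1 / \<alpha>) f"
proof -
  obtain K where K: "0 < K" "\<And>P (X :: (nat \<Rightarrow> 'a) set) (Y :: (nat \<Rightarrow> 'a) set) \<mu> c L W f.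
    \<lbrakk>incidence_controlled P X Y \<mu> c L W; \<forall>x\<in>X. 0 \<le> f x\<rbrakk> \<Longrightarrow>
    (\<Sum>y\<in>Y. (\<Sum>x\<in>X. f x * of_bool (P x y)) powr (1 / (1 - \<beta>))) powr (1 - \<beta>) \<le>
      K * (\<mu> * real (card X) powr (1 - \<alpha>) * real (card Y) powr (1 - \<beta>)
         + c * (L powr (1 - min \<alpha> \<beta>) + W powr (2 - \<alpha> - \<beta>))) * (\<Sum>x\<in>X. f x powr (1 / \<alpha>)) powr \<alpha>"
    using strong_type_bound[OF \<alpha> \<beta> neq, where ?'x = "nat \<Rightarrow> 'a" and ?'y = "nat \<Rightarrow> 'a"] by blast
  have "Lr_norm_cone F d (1 / (1 - \<beta>)) (cone_average F d f) \<le> (72 * K) * Lp_norm_dx F d (1 / \<alpha>) f"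
    if F: "finite_field_odd F" for F :: "'a ring" and f
  proof -
    have fld: "field F" and fin: "finite (carrier F)" and odd: "odd (card (carrier F))"
      using F by (auto simp: finite_field_odd_def)
    let ?V = "coord_space F d" and ?C = "cone F d"
    let ?P = "\<lambda>x y. cone_form F d x = cone_bilinear F d x y"
    interpret S: finite_quadratic_space F ?V "coord_origin F d" "coord_axpy F d" "cone_form F d" "cone_bilinear F d"
      by (rule cone_quadratic_space[OF fld fin odd d])
    have C: "S.C = ?C" unfolding S.C_def cone_eq[OF fld d] ..
    have nontrivial: "\<exists>x\<in>S.C. x \<noteq> coord_origin F d" unfolding C by (rule exists_nonzero_cone[OF fld d])
    define q where "q = real (card (carrier F))"
    define n where "n = real (card ?C)"
    have q: "1 < q" "S.q = q" using S.q_ge_2 unfolding q_def S.q_def by auto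
    have card_V: "real (card ?V) = q powr real d"
      using q(1) unfolding coord_space_def q_def by (simp add: card_PiE powr_realpow)
    have N: "S.N = q powr real d" "real (card ?V) = q powr real d"
      unfolding S.N_def by (fact card_V)+
    have NL: "S.N / S.q = q powr (real d - 1)" using q N by (simp add: powr_diff)
    have n: "q powr (real d - 1) / 2 \<le> n" "n \<le> 2 * q powr (real d - 1)"
      using S.card_C_ge[OF nontrivial] S.card_C_le[OF nontrivial] unfolding NL C n_def .
    have n0: "0 < n" using n(1) q by (smt (verit) powr_gt_zero half_gt_zero)
    define u where "u y = (\<Sum>x\<in>?V. cmod (f x) * of_bool (?P x y))" for y
    define T where "T = (\<Sum>x\<in>?V. cmod (f x) powr (1 / \<alpha>))"
    define Z where "Z = 2 / q * (q powr real d) powr (1 - \<alpha>) * n powr (1 - \<beta>)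
      + 7 * ((q powr real d / q) powr (1 - min \<alpha> \<beta>) + sqrt (q powr real d) powr (2 - \<alpha> - \<beta>))"
    have u0: "0 \<le> u y" for y unfolding u_def by (intro sum_nonneg) auto
    have T0: "0 \<le> T" unfolding T_def by (intro sum_nonneg) auto
    have "(\<Sum>y\<in>?C. u y powr (1 / (1 - \<beta>))) powr (1 - \<beta>) \<le> K * Z * T powr \<alpha>"
      using K(2)[OF S.incidence_controlled_V_C[OF nontrivial], of "\<lambda>x. cmod (f x)"]
      unfolding C q(2) N Z_def T_def u_def n_def by simp
    note main = this
    have average: "cmod (cone_average F d f y) \<le> u y / n" if y: "y \<in> ?C" for y
    proof -
      have yV: "y \<in> ?V" using y by (simp add: cone_def)
      have "cmod (\<Sum>x\<in>?C. f (vec_minus F d y x)) \<le> (\<Sum>x\<in>?C. cmod (f (vec_minus F d y x)))"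
        by (rule norm_sum)
      also have "\<dots> = (\<Sum>x\<in>?C. cmod (f (coord_axpy F d (\<ominus>\<^bsub>F\<^esub> \<one>\<^bsub>F\<^esub>) x y)))"
        using yV by (intro sum.cong refl) (simp add: vec_minus_eq[OF fld] cone_def)
      also have "\<dots> = u y"
        using S.sum_translate_C[of y "\<lambda>x. cmod (f x)"] y unfolding C u_def by simp
      finally have "cmod (\<Sum>x\<in>?C. f (vec_minus F d y x)) / n \<le> u y / n"
        using n0 by (intro divide_right_mono) auto
      then show ?thesis using y by (simp add: cone_average_def norm_mult norm_divide n_def)
    qed
    define r where "r = 1 / (1 - \<beta>)"
    have r: "0 < r" "1 / r = 1 - \<beta>" "r * (1 - \<beta>) = 1" using \<beta> by (auto simp: r_def)
    have "(\<Sum>y\<in>?C. cmod (cone_average F d f y) powr r) \<le> (\<Sum>y\<in>?C. (u y / n) powr r)"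
      using r average by (intro sum_mono powr_mono2) auto
    also have "\<dots> = n powr (- r) * (\<Sum>y\<in>?C. u y powr r)"
      using u0 n0 by (simp add: sum_distrib_left powr_divide powr_minus_divide)
    finally have "1 / n * (\<Sum>y\<in>?C. cmod (cone_average F d f y) powr r) \<le> 1 / n * (n powr (- r) * (\<Sum>y\<in>?C. u y powr r))"
      using n0 by (intro mult_left_mono) auto
    \<comment> \<open>\<open>r\<close> powers of \<open>1/n\<close> come from the average and one
      from the normalised measure on the cone.\<close>
    also have "\<dots> = n powr (- (1 + r)) * (\<Sum>y\<in>?C. u y powr r)"
      using n0 by (simp add: powr_diff powr_minus_divide powr_add)
    finally have "Lr_norm_cone F d r (cone_average F d f) \<le> (n powr (- (1 + r)) * (\<Sum>y\<in>?C. u y powr r)) powr (1 - \<beta>)"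
      unfolding Lr_norm_cone_def n_def[symmetric] r(2) using \<beta> n0
      by (intro powr_mono2) (auto intro!: sum_nonneg divide_nonneg_pos)
    also have "\<dots> = n powr (- (2 - \<beta>)) * (\<Sum>y\<in>?C. u y powr r) powr (1 - \<beta>)"
    proof -
      have "- (1 + r) * (1 - \<beta>) = - (2 - \<beta>)" using r(3) by (simp add: algebra_simps)
      then have "(n powr (- (1 + r))) powr (1 - \<beta>) = n powr (- (2 - \<beta>))" by (simp only: powr_powr)
      then show ?thesis by (simp add: powr_mult sum_nonneg)
    qed
    also have "\<dots> \<le> n powr (- (2 - \<beta>)) * (K * Z * T powr \<alpha>)"
      using main unfolding r_def by (intro mult_left_mono) auto
    also have "\<dots> = K * T powr \<alpha> * (n powr (- (2 - \<beta>)) * Z)" by simp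
    also have "\<dots> \<le> K * T powr \<alpha> * (72 * q powr (- (real d * \<alpha>)))"
      using K(1) \<beta> unfolding Z_def
      by (intro mult_left_mono exponent_bookkeeping[OF q(1) n _ _ balance1 balance2]) auto
    also have "\<dots> = (72 * K) * Lp_norm_dx F d (1 / \<alpha>) f"
    proof -
      have "Lp_norm_dx F d (1 / \<alpha>) f = (T / q ^ d) powr \<alpha>"
        by (simp add: Lp_norm_dx_def T_def q_def)
      also have "\<dots> = T powr \<alpha> / (q powr real d) powr \<alpha>"
        using q(1) T0 by (simp add: powr_divide powr_realpow)
      also have "\<dots> = T powr \<alpha> * q powr (- (real d * \<alpha>))"
        by (simp only: powr_powr powr_minus_divide) simp
      finally show ?thesis by simp
    qed
    finally show ?thesis unfolding r_def .
  qed
  then show ?thesis using K(1) by (intro exI[of _ "72 * K"]) auto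
qed

theorem theorem1p3:
  fixes d :: nat
  shows
    "(even d \<and> d \<ge> 6 \<longrightarrow>
       (\<exists>c::real. c > 0 \<and>
         (\<forall>(F :: 'a ring) (f :: (nat \<Rightarrow> 'a) \<Rightarrow> complex). finite_field_odd F \<longrightarrow>
            Lr_norm_cone F d (real d - 2) (cone_average F d f)
              \<le> c * Lp_norm_dx F d (real d / (real d - 1)) f)))
     \<and>
     (even d \<and> d \<ge> 4 \<longrightarrow>
       (\<exists>c::real. c > 0 \<and>
         (\<forall>(F :: 'a ring) (f :: (nat \<Rightarrow> 'a) \<Rightarrow> complex). finite_field_odd F \<longrightarrow>
            Lr_norm_cone F d ((real d ^ 2 - 2 * real d + 2) / (real d - 2)) (cone_average F d f)
              \<le> c * Lp_norm_dx F d
                  ((real d ^ 2 - 2 * real d + 2) / (real d ^ 2 - 3 * real d + 2)) f)))"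
proof (intro conjI impI)
  assume "even d \<and> d \<ge> 6"
  then have d: "3 \<le> d" "6 \<le> real d" by auto
  \<comment> \<open>The solution of the balance equations under
    \<open>min \<alpha> \<beta> = \<beta>\<close>, where they reduce to
    \<open>d \<alpha> = d - 1\<close> and
    \<open>d (1 - \<alpha>) = (d - 2) (1 - \<beta>)\<close>.\<close>
  define \<alpha> \<beta> where "\<alpha> = (real d - 1) / real d" and "\<beta> = (real d - 3) / (real d - 2)"
  have ab: "1 - \<alpha> = 1 / real d" "1 - \<beta> = 1 / (real d - 2)"
    using d by (auto simp: \<alpha>_def \<beta>_def field_simps)
  have order: "\<beta> < \<alpha>"
  proof -
    have "1 / real d < 1 / (real d - 2)" using d by (intro divide_strict_left_mono) auto
    then show ?thesis using ab by linarith
  qed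
  then have min: "min \<alpha> \<beta> = \<beta>" by simp
  \<comment> \<open>\<beta> > 1/2 amounts to \<open>d > 4\<close>: at \<open>d = 4\<close> it would
    be exactly 1/2, and the ratio of decay in \<open>dyadic_sqrt_min_sum\<close> would be 1.\<close>
  have half: "1/2 < \<alpha>" "1/2 < \<beta>" "\<alpha> < 1" "\<beta> < 1"
    using d by (auto simp: \<alpha>_def \<beta>_def field_simps)
  have "real d * \<alpha> = real d - 1" using d by (simp add: \<alpha>_def)
  then have balance1: "(real d - 1) * (1 - min \<alpha> \<beta>) = (real d - 1) * (2 - \<beta>) - real d * \<alpha>"
    unfolding min by (simp add: algebra_simps)
  have "real d / 2 * (2 - \<alpha> - \<beta>) = (real d - 1) * (1 - \<beta>)"
  proof -
    have "2 - \<alpha> - \<beta> = 1 / real d + 1 / (real d - 2)" using ab by simp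
    then show ?thesis unfolding ab(2) using d by (simp add: field_simps)
  qed
  then have balance2: "real d / 2 * (2 - \<alpha> - \<beta>) = (real d - 1) * (2 - \<beta>) - real d * \<alpha>"
    using balance1 min by simp
  have exps: "1 / (1 - \<beta>) = real d - 2" "1 / \<alpha> = real d / (real d - 1)"
    using ab by (auto simp: \<alpha>_def)
  show "\<exists>c::real. c > 0 \<and>
         (\<forall>(F :: 'a ring) (f :: (nat \<Rightarrow> 'a) \<Rightarrow> complex). finite_field_odd F \<longrightarrow>
            Lr_norm_cone F d (real d - 2) (cone_average F d f)
              \<le> c * Lp_norm_dx F d (real d / (real d - 1)) f)"
    using cone_average_bound[OF d(1) half(1,3,2,4) _ balance1 balance2] order unfolding exps by blast
next
  assume "even d \<and> d \<ge> 4"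
  then have d: "3 \<le> d" "4 \<le> real d" by auto
  define D where "D = real d ^ 2 - 2 * real d + 2"
  \<comment> \<open>The solution of the same equations under
    \<open>min \<alpha> \<beta> = \<alpha>\<close>. For \<open>a = 1 - \<alpha>\<close> and
    \<open>b = 1 - \<beta>\<close> they reduce to \<open>d b = (d - 2) a\<close> and
    \<open>a + (d - 1) b = 1\<close>, whence the denominator \<open>D\<close>.\<close>
  define \<alpha> \<beta> where "\<alpha> = (real d ^ 2 - 3 * real d + 2) / D" and "\<beta> = (real d ^ 2 - 3 * real d + 4) / D"
  have sq: "4 * real d \<le> real d ^ 2" using d by (simp add: power2_eq_square)
  have D: "0 < D" unfolding D_def using sq d by simp
  have ab: "1 - \<alpha> = real d / D" "1 - \<beta> = (real d - 2) / D"
    using D by (auto simp: \<alpha>_def \<beta>_def diff_divide_eq_iff) (auto simp: D_def)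
  have order: "\<alpha> < \<beta>" unfolding \<alpha>_def \<beta>_def using D by (intro divide_strict_right_mono) auto
  then have min: "min \<alpha> \<beta> = \<alpha>" by simp
  \<comment> \<open>\<alpha> > 1/2 amounts to \<open>2 d < D\<close>, which already holds at
    \<open>d = 4\<close>, where \<open>D = 10\<close>.\<close>
  have half: "1/2 < \<alpha>" "1/2 < \<beta>" "\<alpha> < 1" "\<beta> < 1"
  proof -
    have "real d / D < 1 / 2" "0 < real d / D" "0 < (real d - 2) / D"
      using D d sq by (auto simp: D_def field_simps)
    then show "1/2 < \<alpha>" "\<alpha> < 1" "\<beta> < 1" "1/2 < \<beta>" using ab order by linarith+
  qed
  have "(real d - 1) * (1 - \<alpha>) * D = ((real d - 1) * (2 - \<beta>) - real d * \<alpha>) * D"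
  proof -
    have "(1 - \<alpha>) * D = real d" "\<beta> * D = real d ^ 2 - 3 * real d + 4" "\<alpha> * D = real d ^ 2 - 3 * real d + 2"
      using D ab by (auto simp: \<alpha>_def \<beta>_def)
    moreover have "((real d - 1) * (2 - \<beta>) - real d * \<alpha>) * D = (real d - 1) * (2 * D - \<beta> * D) - real d * (\<alpha> * D)"
      by (simp add: algebra_simps)
    ultimately show ?thesis
      by (simp only: mult.assoc) (simp add: D_def power2_eq_square algebra_simps)
  qed
  then have balance1: "(real d - 1) * (1 - min \<alpha> \<beta>) = (real d - 1) * (2 - \<beta>) - real d * \<alpha>"
    unfolding min using D by simp
  have "real d / 2 * (2 - \<alpha> - \<beta>) = (real d - 1) * (1 - \<alpha>)"
  proof -
    have "2 - \<alpha> - \<beta> = (2 * real d - 2) / D" using ab by (simp add: diff_divide_distrib add_divide_distrib)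
    also have "\<dots> = 2 * ((real d - 1) / D)"
      by (simp only: times_divide_eq_right right_diff_distrib mult_1_right)
    finally have sum: "2 - \<alpha> - \<beta> = 2 * ((real d - 1) / D)" .
    have cancel: "real d / 2 * (2 * k) = real d * k" for k by simp
    show ?thesis unfolding sum ab(1) cancel by (simp add: mult.commute)
  qed
  then have balance2: "real d / 2 * (2 - \<alpha> - \<beta>) = (real d - 1) * (2 - \<beta>) - real d * \<alpha>"
    using balance1 min by simp
  have exps: "1 / (1 - \<beta>) = D / (real d - 2)" "1 / \<alpha> = D / (real d ^ 2 - 3 * real d + 2)"
    using ab by (auto simp: \<alpha>_def)
  show "\<exists>c::real. c > 0 \<and>
         (\<forall>(F :: 'a ring) (f :: (nat \<Rightarrow> 'a) \<Rightarrow> complex). finite_field_odd F \<longrightarrow>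
            Lr_norm_cone F d ((real d ^ 2 - 2 * real d + 2) / (real d - 2)) (cone_average F d f)
              \<le> c * Lp_norm_dx F d
                  ((real d ^ 2 - 2 * real d + 2) / (real d ^ 2 - 3 * real d + 2)) f)"
    using cone_average_bound[OF d(1) half(1,3,2,4) _ balance1 balance2] order unfolding exps D_def by blast
qed

end
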